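(* Let $T\in\mathbb{R}_+$ be a finite time horizon. Let $A \in \mathbb{R}^{n\times n}$, $B = [B_1 \ \cdots\ B_m] \in \mathbb{R}^{n\times m}$ (columns $B_i$), $F \in \mathbb{R}^{n \times l}_+$, $H \in \mathbb{R}^{n \times c}$, $E = [E_1^{\top}\ \cdots\ E_m^{\top}]^{\top} \in \mathbb{R}_{+}^{m \times n}$ (rows $E_i$) with $E_i \neq 0$ for all $i$, $G\in \mathbb{R}^{c \times n}_{+}$, $s \in \mathbb{R}^{n}$, $r \in \mathbb{R}^{m}$, $\gamma \in \mathbb{R}^{l}_{+}$ and $\delta \in \mathbb{R}^{c}$. Suppose that $A-|B|E-|H|G$ is Metzler and that $s \geq E^{\top}|r| - G^{\top}|\delta|$. Consider the optimal control problem $$\inf_{\mu}\ \max_{w,v}\ \int_0^T \left[s^{\top}x(\tau)+r^{\top}u(\tau)-\gamma^{\top}w(\tau)-\delta^{\top}v(\tau)\right]d\tau$$ subject to $\dot x(t)=Ax(t)+Bu(t)+Fw(t)+Hv(t)$, $x(0)=x_0\in\mathbb{R}^n_+$, $u(t)=\mu(x(t))$, $|u|\le Ex$, $w\ge 0$, $|v|\le Gx$. Then the following statements are equivalent: (i) The optimal control problem has a finite optimal value for every $x_0\in\mathbb{R}^n_+$. (ii) The differential equation in $p(t)\in\mathbb{R}^n$ $$-\dot p(t) = s + A^{\top}p(t) - E^{\top}\left|r+B^{\top}p(t)\right| + G^{\top}\left|-\delta+H^{\top}p(t)\right|,\qquad p(T)=0,$$ has a unique solution (on $[0,T]$), and $\gamma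 \ge F^{\top}p(0)$. Moreover, if these conditions hold, the minimal value of the optimal control problem is $p(0)^{\top}x_0$, and the optimal control policy is given by $u^*(t)=-K(t)x^*(t)$ with $$K(t)\in\begin{bmatrix}\operatorname{sign}(r_1+p(t)^{\top}B_1)E_1\\ \vdots\\ \operatorname{sign}(r_m+p(t)^{\top}B_m)E_m\end{bmatrix}.$$
   Context: Inequalities between vectors or matrices are elementwise, $|X|$ denotes the elementwise absolute value, and $\mathbb{R}^n_+$, $\mathbb{R}^{m\times n}_+$ denote vectors/matrices with nonnegative entries. A square matrix is Metzler if its off-diagonal entries are nonnegative. The signum is set-valued: $\operatorname{sign}(y)=\{+1\}$ if $y>0$, $\{-1\}$ if $y<0$, and $[-1,1]$ if $y=0$; the inclusion for $K(t)$ means that the $i$-th row of $K(t)$ is $\sigma E_i$ for some $\sigma\in\operatorname{sign}(r_i+p(t)^{\top}B_i)$. In the optimal control problem, $\mu$ ranges over all (potentially nonlinear and time-varying) state-feedback policies producing a control $u(t)\in\mathbb{R}^m$ with $|u(t)|\le Ex(t)$, and $w$ and $v$ range over all disturbance functions of time with $w(t)\in\mathbb{R}^l$, $w(t)\ge 0$ and $v(t)\in\mathbb{R}^c$, $|v(t)|\le Gx(t)$, for which the dynamics and the cost are well defined. $x^*$ denotes the resulting optimal state trajectory. *)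

theory Defs
  imports "HOL-Analysis.Analysis"
begin

(* On "real^'n" and "real^'n^'m" the library's order and absolute value are elementwise. *)

definition metzler :: "real^'n^'n \<Rightarrow> bool" where
  "metzler M \<longleftrightarrow> (\<forall>i j. i \<noteq> j \<longrightarrow> 0 \<le> M $ i $ j)"

definition sign_set :: "real \<Rightarrow> real set" where
  "sign_set y = (if y > 0 then {1} else if y < 0 then {-1} else {-1..1})"

(* The locale has no assumptions; it only fixes the data of the problem. *)

locale minimax_problem =
  fixes T :: real
    and A :: "real^'n^'n" and B :: "real^'m^'n"
    and F :: "real^'l^'n" and H :: "real^'c^'n"
    and E :: "real^'n^'m" and G :: "real^'n^'c"
    and s :: "real^'n" and r :: "real^'m"
    and \<gamma> :: "real^'l" and \<delta> :: "real^'c"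
begin

definition velocity ::
  "(real \<Rightarrow> real^'n \<Rightarrow> real^'m) \<Rightarrow> (real \<Rightarrow> real^'l) \<Rightarrow> (real \<Rightarrow> real^'c) \<Rightarrow> (real \<Rightarrow> real^'n)
    \<Rightarrow> real \<Rightarrow> real^'n" where
  "velocity \<mu> w v x t = A *v x t + B *v \<mu> t (x t) + F *v w t + H *v v t"

definition running_cost ::
  "(real \<Rightarrow> real^'n \<Rightarrow> real^'m) \<Rightarrow> (real \<Rightarrow> real^'l) \<Rightarrow> (real \<Rightarrow> real^'c) \<Rightarrow> (real \<Rightarrow> real^'n)
    \<Rightarrow> real \<Rightarrow> real" where
  "running_cost \<mu> w v x t = s \<bullet> x t + r \<bullet> \<mu> t (x t) - \<gamma> \<bullet> w t - \<delta> \<bullet> v t"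

definition cost ::
  "(real \<Rightarrow> real^'n \<Rightarrow> real^'m) \<Rightarrow> (real \<Rightarrow> real^'l) \<times> (real \<Rightarrow> real^'c) \<times> (real \<Rightarrow> real^'n)
    \<Rightarrow> real" where
  "cost \<mu> = (\<lambda>(w, v, x). integral {0..T} (running_cost \<mu> w v x))"

(* Disturbances w, v together with a resulting state x. The differential equation is meant in the
   Caratheodory sense: x is absolutely continuous and satisfies it almost everywhere, written in
   integrated form. The integrability conditions say that dynamics and cost are well defined. *)

definition trajectories ::
  "real^'n \<Rightarrow> (real \<Rightarrow> real^'n \<Rightarrow> real^'m)
    \<Rightarrow> ((real \<Rightarrow> real^'l) \<times> (real \<Rightarrow> real^'c) \<times> (real \<Rightarrow> real^'n)) set" where
  "trajectories x0 \<mu> = {(w, v, x).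
     velocity \<mu> w v x absolutely_integrable_on {0..T} \<and>
     (\<forall>t\<in>{0..T}. (velocity \<mu> w v x has_integral (x t - x0)) {0..t}) \<and>
     running_cost \<mu> w v x absolutely_integrable_on {0..T} \<and>
     (\<forall>t\<in>{0..T}. \<bar>\<mu> t (x t)\<bar> \<le> E *v x t \<and> 0 \<le> w t \<and> \<bar>v t\<bar> \<le> G *v x t)}"

(* Time-varying, possibly nonlinear feedback laws that satisfy the input constraint on the
   nonnegative orthant and whose closed loop is well defined against every disturbance: otherwise
   a law could restrict its opponent by having no closed-loop solution. As the bound on v depends
   on the state, a disturbance is given by w and by the fractions d(t) in [-1,1]^c of the bound
   that v uses, v(t) = diag (d t) G x(t); every v with |v| <= G x has this form. Solutions need
   not be unique; the worst case below is over all of them. *)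

definition policies :: "real^'n \<Rightarrow> (real \<Rightarrow> real^'n \<Rightarrow> real^'m) set" where
  "policies x0 = {\<mu>.
     (\<forall>t\<in>{0..T}. \<forall>x\<ge>0. \<bar>\<mu> t x\<bar> \<le> E *v x) \<and>
     (\<forall>w d. w absolutely_integrable_on {0..T} \<longrightarrow> (\<forall>t\<in>{0..T}. 0 \<le> w t) \<longrightarrow>
        d \<in> borel_measurable (lebesgue_on {0..T}) \<longrightarrow> (\<forall>t\<in>{0..T}. \<forall>j. \<bar>d t $ j\<bar> \<le> 1) \<longrightarrow>
        (\<exists>x. (w, \<lambda>t. \<chi> j. d t $ j * (G *v x t) $ j, x) \<in> trajectories x0 \<mu>))}"

definition worst_case_cost :: "real^'n \<Rightarrow> (real \<Rightarrow> real^'n \<Rightarrow> real^'m) \<Rightarrow> ereal" where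
  "worst_case_cost x0 \<mu> = (SUP \<xi>\<in>trajectories x0 \<mu>. ereal (cost \<mu> \<xi>))"

definition optimal_value :: "real^'n \<Rightarrow> ereal" where
  "optimal_value x0 = (INF \<mu>\<in>policies x0. worst_case_cost x0 \<mu>)"

(* For an optimal policy the supremum over the disturbances has to be a maximum, attained along
   some closed-loop trajectory. *)

definition optimal_policy :: "real^'n \<Rightarrow> (real \<Rightarrow> real^'n \<Rightarrow> real^'m) \<Rightarrow> bool" where
  "optimal_policy x0 \<mu> \<longleftrightarrow>
     \<mu> \<in> policies x0 \<and> worst_case_cost x0 \<mu> = optimal_value x0 \<and>
     (\<exists>\<xi>\<in>trajectories x0 \<mu>. ereal (cost \<mu> \<xi>) = worst_case_cost x0 \<mu>)"

definition solves_costate :: "(real \<Rightarrow> real^'n) \<Rightarrow> bool" where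
  "solves_costate p \<longleftrightarrow>
     (\<forall>t\<in>{0..T}. (p has_vector_derivative
        - (s + transpose A *v p t - transpose E *v \<bar>r + transpose B *v p t\<bar>
           + transpose G *v \<bar>- \<delta> + transpose H *v p t\<bar>)) (at t within {0..T})) \<and>
     p T = 0"

definition unique_costate :: "(real \<Rightarrow> real^'n) \<Rightarrow> bool" where
  "unique_costate p \<longleftrightarrow>
     solves_costate p \<and> (\<forall>q. solves_costate q \<longrightarrow> (\<forall>t\<in>{0..T}. q t = p t))"

(* K is any measurable selection; without measurability the closed loop is not defined. *)

definition optimal_gain :: "(real \<Rightarrow> real^'n) \<Rightarrow> (real \<Rightarrow> real^'n^'m) \<Rightarrow> bool" where
  "optimal_gain p K \<longleftrightarrow>
     K \<in> borel_measurable (lebesgue_on {0..T}) \<and>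
     (\<forall>t\<in>{0..T}. \<forall>i. \<exists>\<sigma>\<in>sign_set (r $ i + p t \<bullet> column i B). row i (K t) = \<sigma> *\<^sub>R row i E)"

end

end

theory Submission
  imports Defs
begin

text \<open>The right-hand side of the costate equation is globally Lipschitz, so a unique costate \<open>p\<close> always
  exists and the condition \<open>F\<^sup>T p(0) \<le> \<gamma>\<close> is the only content of (ii). Integrating the derivative of
  \<open>p \<bullet> x\<close> along a trajectory writes the cost as \<open>p(0) \<bullet> x0\<close> plus the integral of a nonnegative control
  term, which vanishes for \<open>u = - K x\<close>, of a nonpositive term in \<open>v\<close>, which vanishes for
  \<open>v = sign (H\<^sup>T p - \<delta>) G x\<close>, and of \<open>(F\<^sup>T p - \<gamma>) \<bullet> w\<close>. The Metzler condition makes the costate equation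
  cooperative, hence \<open>p\<close> decreasing in time, so that the last term is nonpositive for all times as soon
  as \<open>F\<^sup>T p(0) \<le> \<gamma>\<close>; otherwise an impulse in \<open>w\<close> near time 0 makes the value infinite. The Metzler
  condition also keeps the closed loop under \<open>u = - K x\<close> in the nonnegative orthant, where the
  constraints are meaningful.\<close>

section \<open>Differential inequalities and differential equations\<close>

text \<open>The integral of \<open>\<psi>\<close> times \<open>exp (- c * u)\<close> starts at 0 and
  does not increase, since its derivative has the sign of \<open>\<psi> u\<close> minus
  \<open>c\<close> times that integral. So the integral is at most 0, and the bound then forces
  \<open>\<psi>\<close> to vanish.\<close>

lemma gronwall_zero:
  fixes \<psi> :: "real \<Rightarrow> real"
  assumes cont: "continuous_on {0..T} \<psi>"
    and nonneg: "\<And>t. t \<in> {0..T} \<Longrightarrow> 0 \<le> \<psi> t"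
    and bound: "\<And>t. t \<in> {0..T} \<Longrightarrow> \<psi> t \<le> c * integral {0..t} \<psi>"
    and "0 \<le> c" and t: "t \<in> {0..T}"
  shows "\<psi> t = 0"
proof -
  define h where "h = (\<lambda>u. integral {0..u} \<psi> * exp (- c * u))"
  have "h 0 \<ge> h t"
  proof (rule DERIV_nonpos_imp_decreasing_open[of 0 t h])
    show "0 \<le> t" using t by simp
    have "continuous_on {0..T} (\<lambda>u. integral {0..u} \<psi>)"
      by (intro indefinite_integral_continuous_1 integrable_continuous_real cont)
    then show "continuous_on {0..t} h" unfolding h_def
      by (intro continuous_intros) (rule continuous_on_subset, use t in auto)
    fix u assume u: "0 < u" "u < t"
    have "((\<lambda>u. integral {0..u} \<psi>) has_real_derivative \<psi> u) (at u within {0..T})"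
      by (rule integral_has_real_derivative[OF cont]) (use u t in auto)
    moreover have "at u within {0..T} = at u"
      by (rule at_within_Icc_at) (use u t in auto)
    ultimately have D: "((\<lambda>u. integral {0..u} \<psi>) has_real_derivative \<psi> u) (at u)" by simp
    have "(h has_real_derivative (\<psi> u - c * integral {0..u} \<psi>) * exp (- c * u)) (at u)"
      unfolding h_def by (rule derivative_eq_intros D refl | simp add: algebra_simps)+
    moreover have "(\<psi> u - c * integral {0..u} \<psi>) * exp (- c * u) \<le> 0"
      using bound[of u] u t by (simp add: mult_le_0_iff)
    ultimately show "\<exists>y. DERIV h u :> y \<and> y \<le> 0" by blast
  qed
  then have "integral {0..t} \<psi> \<le> 0" by (simp add: h_def mult_le_0_iff)
  then have "\<psi> t \<le> 0" using bound[OF t] \<open>0 \<le> c\<close> by (meson mult_nonneg_nonpos order_trans)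
  with nonneg[OF t] show ?thesis by simp
qed

text \<open>Forward invariance of the nonnegative orthant: a negative component cannot fall faster
  than \<open>c\<close> times the sum \<open>\<psi>\<close> of all negative parts. Integrating from
  its last zero and summing over the components leaves a Gronwall inequality for
  \<open>\<psi>\<close>. The integrated form covers solutions that satisfy their equation only
  almost everywhere.\<close>

lemma nonneg_of_cooperative:
  fixes y g :: "real \<Rightarrow> real^'n"
  assumes y: "\<And>t. t \<in> {0..T} \<Longrightarrow> (g has_integral (y t - y 0)) {0..t}"
    and y0: "0 \<le> y 0" and "0 \<le> c"
    and low: "\<And>t i. t \<in> {0..T} \<Longrightarrow> y t $ i \<le> 0 \<Longrightarrow> - c * (\<Sum>j\<in>UNIV. max 0 (- y t $ j)) \<le> g t $ i"
    and t: "t \<in> {0..T}"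
  shows "0 \<le> y t"
proof -
  define \<psi> where "\<psi> = (\<lambda>t. \<Sum>j\<in>UNIV. max 0 (- y t $ j))"
  have gint: "g integrable_on {0..T}" using y[of T] t by auto
  have "continuous_on {0..T} (\<lambda>u. y 0 + integral {0..u} g)"
    by (intro continuous_intros indefinite_integral_continuous_1 gint)
  moreover have "y 0 + integral {0..u} g = y u" if "u \<in> {0..T}" for u
    using y[OF that] by (simp add: integral_unique)
  ultimately have ycont: "continuous_on {0..T} y"
    by (metis (no_types, lifting) continuous_on_cong)
  have yic: "continuous_on {0..T} (\<lambda>t. y t $ i)" for i
    using ycont by (intro continuous_intros)
  have \<psi>cont: "continuous_on {0..T} \<psi>"
    unfolding \<psi>_def by (intro continuous_intros continuous_on_max yic)
  have \<psi>nonneg: "0 \<le> \<psi> t" for t by (simp add: \<psi>_def sum_nonneg)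
  have \<psi>int: "\<psi> integrable_on {a..b}" if "0 \<le> a" "b \<le> T" for a b
    by (rule integrable_continuous_real, rule continuous_on_subset[OF \<psi>cont]) (use that in auto)
  have comp: "max 0 (- y u $ i) \<le> c * integral {0..u} \<psi>" if u: "u \<in> {0..T}" for u i
  proof (cases "y u $ i \<ge> 0")
    case True
    then show ?thesis using \<open>0 \<le> c\<close> \<psi>nonneg by (simp add: integral_nonneg \<psi>int u[simplified])
  next
    case False
    \<comment> \<open>The supremum of \<open>S\<close> is the last time up to \<open>u\<close> at
      which component \<open>i\<close> is nonnegative. By the intermediate value theorem the
      component is zero there; it stays nonpositive up to \<open>u\<close>, so \<open>low\<close>
      applies on all of \<open>{a..u}\<close>.\<close>
    define S where "S = {a \<in> {0..u}. 0 \<le> y a $ i}"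
    have "0 \<in> S" using y0 u by (simp add: S_def less_eq_vec_def)
    have "closed S"
    proof -
      have "continuous_on {0..u} (\<lambda>t. y t $ i)"
        by (rule continuous_on_subset[OF yic]) (use u in auto)
      then have "closed ({0..u} \<inter> (\<lambda>t. y t $ i) -` {0..})"
        by (rule continuous_closed_preimage) auto
      moreover have "{0..u} \<inter> (\<lambda>t. y t $ i) -` {0..} = S" by (auto simp: S_def)
      ultimately show ?thesis by simp
    qed
    have bdd: "bdd_above S" by (rule bdd_aboveI[of _ u]) (simp add: S_def)
    define a where "a = Sup S"
    have aS: "a \<in> S"
      unfolding a_def using \<open>0 \<in> S\<close> bdd \<open>closed S\<close> by (intro closed_contains_Sup) auto
    then have a: "0 \<le> a" "a \<le> u" "0 \<le> y a $ i" by (auto simp: S_def)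
    have aa: "y a $ i = 0"
    proof (rule ccontr)
      assume "y a $ i \<noteq> 0"
      with a have "y a $ i > 0" by simp
      moreover have "continuous_on {a..u} (\<lambda>t. y t $ i)"
        by (rule continuous_on_subset[OF yic]) (use a u in auto)
      ultimately obtain b where b: "a \<le> b" "b \<le> u" "y b $ i = 0"
        using IVT2'[of "\<lambda>t. y t $ i" u 0 a] False a by force
      then have "b \<in> S" using a by (simp add: S_def)
      then have "b \<le> a" unfolding a_def using bdd by (rule cSup_upper)
      with b \<open>y a $ i > 0\<close> show False by simp
    qed
    have neg: "y b $ i \<le> 0" if "b \<in> {a..u}" for b
    proof (rule ccontr)
      assume "\<not> ?thesis"
      then have "b \<in> S" using that a by (simp add: S_def)
      then have "b \<le> a" unfolding a_def using bdd by (rule cSup_upper)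
      then have "b = a" using that by simp
      with aa \<open>\<not> y b $ i \<le> 0\<close> show False by simp
    qed
    have gau: "g integrable_on {a..u}"
      by (rule integrable_subinterval_real[OF gint]) (use a u in auto)
    have "integral {0..a} g + integral {a..u} g = integral {0..u} g"
      by (rule Henstock_Kurzweil_Integration.integral_combine[OF a(1,2)],
          rule integrable_subinterval_real[OF gint]) (use a u in auto)
    then have "integral {a..u} g = y u - y a"
      using y[of a] y[of u] a u by (simp add: integral_unique algebra_simps)
    then have "(g has_integral (y u - y a)) {a..u}"
      using gau by (metis integrable_integral)
    from has_integral_linear[OF this bounded_linear_vec_nth[of i]]
    have gi: "((\<lambda>t. g t $ i) has_integral (y u $ i)) {a..u}"
      by (simp add: o_def aa)
    have pi: "((\<lambda>t. - c * \<psi> t) has_integral (- c * integral {a..u} \<psi>)) {a..u}"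
      using \<psi>int[of a u] a u by (intro has_integral_mult_right integrable_integral) auto
    have "- c * \<psi> b \<le> g b $ i" if "b \<in> {a..u}" for b
      unfolding \<psi>_def by (rule low) (use that neg a u in auto)
    then have "- c * integral {a..u} \<psi> \<le> y u $ i"
      by (rule has_integral_le[OF pi gi])
    moreover have "integral {a..u} \<psi> \<le> integral {0..u} \<psi>"
      by (rule integral_subset_le) (use a u \<psi>int \<psi>nonneg in auto)
    ultimately show ?thesis using mult_left_mono[OF _ \<open>0 \<le> c\<close>] False by fastforce
  qed
  \<comment> \<open>All components share the same bound, which the summation multiplies by the
    dimension.\<close>
  have "\<psi> u \<le> (real CARD('n) * c) * integral {0..u} \<psi>" if "u \<in> {0..T}" for u
  proof -
    have "\<psi> u \<le> (\<Sum>j\<in>(UNIV::'n set). c * integral {0..u} \<psi>)"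
      unfolding \<psi>_def by (intro sum_mono) (use comp[OF that] in \<open>simp add: \<psi>_def\<close>)
    then show ?thesis by simp
  qed
  then have "\<psi> t = 0"
    by (intro gronwall_zero[where c="real CARD('n) * c", OF \<psi>cont \<psi>nonneg _ _ t]) (use \<open>0 \<le> c\<close> in auto)
  then have "\<forall>j. max 0 (- y t $ j) = 0"
    unfolding \<psi>_def by (subst (asm) sum_nonneg_eq_0_iff) auto
  then have "0 \<le> y t $ i" for i by (metis max.cobounded2 neg_le_0_iff_le)
  then show ?thesis by (simp add: less_eq_vec_def)
qed

text \<open>Picard iteration for a field that is Lipschitz in the state but merely integrable in
  time along continuous curves. This generality is what a closed loop with a measurable gain and
  integrable disturbances requires.\<close>

lemma caratheodory_picard:
  fixes f :: "real \<Rightarrow> 'a::euclidean_space \<Rightarrow> 'a"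
  assumes int: "\<And>x. continuous_on {0..T} x \<Longrightarrow> (\<lambda>t. f t (x t)) integrable_on {0..T}"
    and lip: "\<And>t x y. t \<in> {0..T} \<Longrightarrow> norm (f t x - f t y) \<le> L * norm (x - y)"
    and "0 < L"
  obtains x where "continuous_on {0..T} x"
    and "\<And>t. t \<in> {0..T} \<Longrightarrow> ((\<lambda>t. f t (x t)) has_integral (x t - x0)) {0..t}"
proof -
  define X where "X = rec_nat (\<lambda>t. x0) (\<lambda>_ x t. x0 + integral {0..t} (\<lambda>s. f s (x s)))"
  have X0: "X 0 = (\<lambda>t. x0)" and XS: "X (Suc n) t = x0 + integral {0..t} (\<lambda>s. f s (X n s))" for n t
    by (simp_all add: X_def)
  have Xcont: "continuous_on {0..T} (X n)" for n
  proof (induction n)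
    case (Suc n)
    have "X (Suc n) = (\<lambda>t. x0 + integral {0..t} (\<lambda>s. f s (X n s)))" by (simp add: XS fun_eq_iff)
    then show ?case by (simp only:) (intro continuous_intros indefinite_integral_continuous_1 int Suc)
  qed (simp add: X0)
  have int': "(\<lambda>t. f t (x t)) integrable_on {0..u}" if "continuous_on {0..T} x" "u \<in> {0..T}" for x u
    by (rule integrable_subinterval_real[OF int[OF that(1)]]) (use that in auto)
  have "compact ((\<lambda>t. X (Suc 0) t - X 0 t) ` {0..T})"
    by (intro compact_continuous_image continuous_intros Xcont compact_Icc)
  then obtain C where C: "\<And>t. t \<in> {0..T} \<Longrightarrow> norm (X (Suc 0) t - X 0 t) \<le> C"
    by (metis (no_types, lifting) bounded_iff compact_imp_bounded imageI)
  \<comment> \<open>If \<open>T\<close> is negative, the interval is empty and \<open>C\<close> may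
    be negative too.\<close>
  define C' where "C' = max C 0"
  \<comment> \<open>The weight \<open>exp (2 * L * t)\<close> lets each iteration halve the
    difference, however long the interval is: the integral of \<open>L * exp (2 * L * s)\<close> up
    to \<open>t\<close> is at most half of \<open>exp (2 * L * t)\<close>.\<close>
  have step: "norm (X (Suc n) t - X n t) \<le> C' * (1/2)^n * exp (2 * L * t)" if "t \<in> {0..T}" for n t
    using that
  proof (induction n arbitrary: t)
    case 0
    have "norm (X (Suc 0) t - X 0 t) \<le> C'" using C[OF 0] by (simp add: C'_def)
    also have "C' * 1 \<le> C' * exp (2 * L * t)"
      using 0 \<open>0 < L\<close> by (intro mult_left_mono) (auto simp: C'_def)
    finally show ?case by simp
  next
    case (Suc n)
    have ei: "((\<lambda>s. L * (C' * (1/2)^n * exp (2 * L * s))) has_integral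
      (C' * (1/2)^(Suc n) * exp (2 * L * t) - C' * (1/2)^(Suc n) * exp (2 * L * 0))) {0..t}"
      using Suc.prems \<open>0 < L\<close>
      by (intro fundamental_theorem_of_calculus)
        (auto intro!: derivative_eq_intros simp flip: has_real_derivative_iff_has_vector_derivative)
    have "X (Suc (Suc n)) t - X (Suc n) t = integral {0..t} (\<lambda>s. f s (X (Suc n) s) - f s (X n s))"
      unfolding XS[of "Suc n" t] XS[of n t]
      by (subst Henstock_Kurzweil_Integration.integral_diff) (simp_all add: int'[OF Xcont Suc.prems])
    also have "norm \<dots> \<le> integral {0..t} (\<lambda>s. L * (C' * (1/2)^n * exp (2 * L * s)))"
    proof (rule integral_norm_bound_integral)
      show "(\<lambda>s. f s (X (Suc n) s) - f s (X n s)) integrable_on {0..t}"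
        by (intro Henstock_Kurzweil_Integration.integrable_diff int'[OF Xcont Suc.prems])
      show "(\<lambda>s. L * (C' * (1/2)^n * exp (2 * L * s))) integrable_on {0..t}" using ei by blast
      fix s assume s: "s \<in> {0..t}"
      then have s': "s \<in> {0..T}" using Suc.prems by auto
      show "norm (f s (X (Suc n) s) - f s (X n s)) \<le> L * (C' * (1/2)^n * exp (2 * L * s))"
        using lip[OF s'] Suc.IH[OF s'] \<open>0 < L\<close> by (meson order_trans mult_left_mono less_imp_le)
    qed
    also have "\<dots> \<le> C' * (1/2)^(Suc n) * exp (2 * L * t)"
      unfolding integral_unique[OF ei] by (simp add: C'_def)
    finally show ?case .
  qed
  have step': "norm (X (Suc n) t - X n t) \<le> C' * exp (2 * L * T) * (1/2)^n" if "t \<in> {0..T}" for n t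
  proof -
    have "C' * (1/2)^n * exp (2 * L * t) \<le> C' * (1/2)^n * exp (2 * L * T)"
      using that \<open>0 < L\<close> by (intro mult_left_mono) (auto simp: C'_def)
    with step[OF that, of n] show ?thesis by (simp add: mult_ac)
  qed
  have "summable (\<lambda>n. C' * exp (2 * L * T) * (1/2)^n :: real)"
    by (intro summable_mult summable_geometric) simp
  note S = Weierstrass_m_test[where A = "{0..T}" and f = "\<lambda>i t. X (Suc i) t - X i t", OF step' this]
  define x where "x = (\<lambda>t. x0 + (\<Sum>i. X (Suc i) t - X i t))"
  have "uniform_limit {0..T} (\<lambda>n t. x0 + (\<Sum>i<n. X (Suc i) t - X i t)) x sequentially"
    unfolding x_def by (intro uniform_limit_intros S)
  moreover have "x0 + (\<Sum>i<n. X (Suc i) t - X i t) = X n t" for n t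
    by (simp add: sum_lessThan_telescope[of "\<lambda>i. X i t"] X0)
  ultimately have lim: "uniform_limit {0..T} X x sequentially"
    by simp
  have xcont: "continuous_on {0..T} x"
    by (rule uniform_limit_theorem[OF _ lim]) (auto simp: Xcont)
  have "((\<lambda>t. f t (x t)) has_integral (x t - x0)) {0..t}" if t: "t \<in> {0..T}" for t
  proof -
    have "norm (x t - x0 - integral {0..t} (\<lambda>s. f s (x s))) \<le> 0 + e" if "0 < e" for e
    proof -
      \<comment> \<open>The residual splits into the distance of \<open>x\<close> from one iterate,
        at most \<open>e'\<close>, and the change of the integral, at most
        \<open>L * T * e'\<close>. Together they make \<open>e\<close>.\<close>
      define e' where "e' = e / (1 + L * T)"
      have T0: "0 \<le> L * T" using t \<open>0 < L\<close> by simp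
      then have "0 < e'" using \<open>0 < e\<close> by (simp add: e'_def)
      then obtain N where N: "\<And>n s. n \<ge> N \<Longrightarrow> s \<in> {0..T} \<Longrightarrow> dist (X n s) (x s) < e'"
        using uniform_limitD[OF lim, of e'] unfolding eventually_sequentially by blast
      have fi: "(\<lambda>s. f s (X N s) - f s (x s)) integrable_on {0..t}"
        by (intro Henstock_Kurzweil_Integration.integrable_diff int'[OF Xcont t] int'[OF xcont t])
      have "norm (integral {0..t} (\<lambda>s. f s (X N s) - f s (x s))) \<le> integral {0..t} (\<lambda>s. L * e')"
      proof (rule integral_norm_bound_integral[OF fi])
        fix s assume "s \<in> {0..t}"
        then have s: "s \<in> {0..T}" using t by auto
        have "L * norm (X N s - x s) \<le> L * e'"
          using N[OF order_refl s] \<open>0 < L\<close> by (simp add: dist_norm)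
        then show "norm (f s (X N s) - f s (x s)) \<le> L * e'" using lip[OF s] by (meson order_trans)
      qed auto
      also have "\<dots> \<le> L * T * e'" using t \<open>0 < L\<close> \<open>0 < e'\<close> by simp
      finally have 1: "norm (integral {0..t} (\<lambda>s. f s (X N s) - f s (x s))) \<le> L * T * e'" .
      have 2: "norm (x t - X (Suc N) t) \<le> e'"
        using N[of "Suc N", OF _ t] by (simp add: dist_norm norm_minus_commute)
      have "x t - x0 - integral {0..t} (\<lambda>s. f s (x s)) =
        (x t - X (Suc N) t) + integral {0..t} (\<lambda>s. f s (X N s) - f s (x s))"
        using int'[OF Xcont t] int'[OF xcont t] by (simp add: XS Henstock_Kurzweil_Integration.integral_diff)
      also have "norm \<dots> \<le> e' + L * T * e'"
        by (rule norm_triangle_le) (use 1 2 in simp)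
      also have "\<dots> = (1 + L * T) * e'" by (simp add: algebra_simps)
      also have "\<dots> = e" using T0 by (simp add: e'_def)
      finally show ?thesis by simp
    qed
    then have "norm (x t - x0 - integral {0..t} (\<lambda>s. f s (x s))) \<le> 0"
      by (rule field_le_epsilon)
    then have "integral {0..t} (\<lambda>s. f s (x s)) = x t - x0" by simp
    with int'[OF xcont t] show ?thesis by (metis integrable_integral)
  qed
  with xcont show ?thesis by (rule that)
qed

lemma has_integral_inner_by_parts:
  fixes p p' x x' :: "real \<Rightarrow> 'a::euclidean_space"
  assumes "0 \<le> T"
    and x: "\<And>t. t \<in> {0..T} \<Longrightarrow> (x' has_integral (x t - x 0)) {0..t}"
    and x': "x' absolutely_integrable_on {0..T}"
    and p: "\<And>t. t \<in> {0..T} \<Longrightarrow> (p has_vector_derivative p' t) (at t within {0..T})"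
    and p': "continuous_on {0..T} p'"
  shows "((\<lambda>t. p' t \<bullet> x t + p t \<bullet> x' t) has_integral (p T \<bullet> x T - p 0 \<bullet> x 0)) {0..T}"
proof -
  define q where "q = (\<lambda>t. p' t \<bullet> x t + p t \<bullet> x' t)"
  define V where "V = (\<lambda>t. integral {0..t} (\<lambda>u. norm (x' u)))"
  define \<phi> where "\<phi> = (\<lambda>t. p t \<bullet> x t - integral {0..t} q)"
  have x'i: "x' integrable_on {0..T}" and Vi: "(\<lambda>u. norm (x' u)) integrable_on {0..T}"
    using x' by (auto simp: absolutely_integrable_on_def)
  have sub: "f integrable_on {a..b}" if "f integrable_on {0..T}" "0 \<le> a" "b \<le> T"
    for f :: "real \<Rightarrow> 'b::euclidean_space" and a b
    by (rule integrable_subinterval_real[OF that(1)]) (use that in auto)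
  have combine: "integral {0..b} f - integral {0..a} f = integral {a..b} f"
    if "f integrable_on {0..T}" "0 \<le> a" "a \<le> b" "b \<le> T"
    for f :: "real \<Rightarrow> 'b::euclidean_space" and a b
    using Henstock_Kurzweil_Integration.integral_combine[OF that(2,3) sub[OF that(1)]] that
    by (simp add: algebra_simps)
  have pcont: "continuous_on {0..T} p"
    using p by (intro continuous_on_vector_derivative)
  have "continuous_on {0..T} (\<lambda>t. x 0 + integral {0..t} x')"
    by (intro continuous_intros indefinite_integral_continuous_1 x'i)
  moreover have "x 0 + integral {0..t} x' = x t" if "t \<in> {0..T}" for t
    using x[OF that] by (simp add: integral_unique)
  ultimately have xcont: "continuous_on {0..T} x"
    by (metis (no_types, lifting) continuous_on_cong)
  have Vcont: "continuous_on {0..T} V"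
    unfolding V_def by (rule indefinite_integral_continuous_1[OF Vi])
  have "(\<lambda>t. p t \<bullet> x' t) absolutely_integrable_on {0..T}"
  proof (rule absolutely_integrable_bounded_measurable_product[where h = "(\<bullet>)", OF _ _ _ _ x'])
    show "bilinear ((\<bullet>) :: 'a \<Rightarrow> 'a \<Rightarrow> real)"
      by (rule bilinear_conv_bounded_bilinear[THEN iffD2]) (rule bounded_bilinear_inner)
    show "p \<in> borel_measurable (lebesgue_on {0..T})"
      by (rule continuous_imp_measurable_on_sets_lebesgue[OF pcont]) simp
    show "bounded (p ` {0..T})"
      by (intro compact_imp_bounded compact_continuous_image pcont compact_Icc)
  qed simp
  then have pxi: "(\<lambda>t. p t \<bullet> x' t) integrable_on {0..T}"
    using absolutely_integrable_on_def by blast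
  have qi: "q integrable_on {0..T}"
    unfolding q_def
    by (intro Henstock_Kurzweil_Integration.integrable_add pxi integrable_continuous_real
        continuous_on_inner p' xcont)
  have "bounded (p' ` {0..T})"
    by (intro compact_imp_bounded compact_continuous_image p' compact_Icc)
  then obtain C where C: "\<And>t. t \<in> {0..T} \<Longrightarrow> norm (p' t) \<le> C" "0 < C"
    by (metis bounded_pos imageI)
  have p'int: "(p' has_integral (p b - p a)) {a..b}" if "0 \<le> a" "a \<le> b" "b \<le> T" for a b
    by (rule fundamental_theorem_of_calculus[OF that(2)])
      (rule has_vector_derivative_within_subset[OF p], use that in auto)
  have lip: "norm (p b - p a) \<le> C * (b - a)" if "0 \<le> a" "a \<le> b" "b \<le> T" for a b
  proof -
    have "norm (p b - p a) \<le> integral {a..b} (\<lambda>_. C)"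
      unfolding integral_unique[OF p'int[OF that], symmetric]
      by (rule integral_norm_bound_integral) (use p'int[OF that] C that in auto)
    then show ?thesis using that by (simp add: mult.commute)
  qed
  have xdiff: "x b - x a = integral {a..b} x'" if "0 \<le> a" "a \<le> b" "b \<le> T" for a b
    using combine[OF x'i that] x[of a] x[of b] that by (simp add: integral_unique)
  have xV: "norm (x b - x a) \<le> V b - V a" if "0 \<le> a" "a \<le> b" "b \<le> T" for a b
    unfolding xdiff[OF that] V_def combine[OF Vi that]
    by (rule integral_norm_bound_integral) (use sub[OF x'i] sub[OF Vi] that in auto)
  have key: "\<bar>\<phi> b - \<phi> a\<bar> \<le> 2 * C * (b - a) * (V b - V a)" if ab: "0 \<le> a" "a \<le> b" "b \<le> T" for a b
  proof -
    \<comment> \<open>The increment of \<open>p \<bullet> x\<close> is exactly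
      \<open>p b \<bullet> (x b - x a) + (p b - p a) \<bullet> x a\<close>. Freezing
      \<open>p\<close> at the right end and \<open>x\<close> at the left end therefore turns the
      error into \<open>(p b - p t) \<bullet> x' t + p' t \<bullet> (x a - x t)\<close>, where each
      product has one small factor.\<close>
    define e where "e = (\<lambda>t. p b \<bullet> x' t + p' t \<bullet> x a - q t)"
    have "((\<lambda>t. p b \<bullet> x' t) has_integral p b \<bullet> (x b - x a)) {a..b}"
      using has_integral_linear[OF integrable_integral[OF sub[OF x'i]] bounded_linear_inner_right, of a b "p b"] ab
      by (simp add: o_def xdiff)
    moreover have "((\<lambda>t. p' t \<bullet> x a) has_integral (p b - p a) \<bullet> x a) {a..b}"
      using has_integral_linear[OF p'int[OF ab] bounded_linear_inner_left, of "x a"] by (simp add: o_def)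
    moreover have "(q has_integral integral {0..b} q - integral {0..a} q) {a..b}"
      unfolding combine[OF qi ab] by (intro integrable_integral sub[OF qi]) (use ab in auto)
    ultimately have "(e has_integral (p b \<bullet> (x b - x a) + (p b - p a) \<bullet> x a
        - (integral {0..b} q - integral {0..a} q))) {a..b}"
      unfolding e_def by (intro has_integral_diff has_integral_add)
    then have e: "(e has_integral \<phi> b - \<phi> a) {a..b}"
      by (simp add: \<phi>_def inner_diff_left inner_diff_right algebra_simps)
    have n: "((\<lambda>t. C * (b - a) * norm (x' t) + C * (V b - V a)) has_integral
        (C * (b - a) * (V b - V a) + (b - a) *\<^sub>R (C * (V b - V a)))) {a..b}"
      unfolding V_def combine[OF Vi ab]
      by (intro has_integral_add has_integral_mult_right integrable_integral sub[OF Vi])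
        (use ab has_integral_const_real[of "C * integral {a..b} (\<lambda>u. norm (x' u))" a b] in auto)
    have "norm (integral {a..b} e) \<le> integral {a..b} (\<lambda>t. C * (b - a) * norm (x' t) + C * (V b - V a))"
    proof (rule integral_norm_bound_integral)
      show "e integrable_on {a..b}" using e by blast
      show "(\<lambda>t. C * (b - a) * norm (x' t) + C * (V b - V a)) integrable_on {a..b}" using n by blast
      fix t assume t: "t \<in> {a..b}"
      have "e t = (p b - p t) \<bullet> x' t + p' t \<bullet> (x a - x t)"
        by (simp add: e_def q_def inner_diff_left inner_diff_right)
      also have "norm \<dots> \<le> norm (p b - p t) * norm (x' t) + norm (p' t) * norm (x a - x t)"
        by (intro norm_triangle_mono) (simp_all add: Cauchy_Schwarz_ineq2)
      also have "\<dots> \<le> C * (b - a) * norm (x' t) + C * (V b - V a)"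
      proof (intro add_mono mult_mono)
        show "norm (p b - p t) \<le> C * (b - a)"
          by (rule order_trans[OF lip mult_left_mono]) (use t ab C(2) in auto)
        have "V t \<le> V b" using order_trans[OF norm_ge_zero xV[of t b]] t ab by auto
        then show "norm (x a - x t) \<le> V b - V a"
          using xV[of a t] t ab by (simp add: norm_minus_commute)
      qed (use C t ab in auto)
      finally show "norm (e t) \<le> C * (b - a) * norm (x' t) + C * (V b - V a)" .
    qed
    then show ?thesis
      unfolding integral_unique[OF e] integral_unique[OF n] by (simp add: algebra_simps)
  qed
  have Vmono: "V a \<le> V b" if "0 \<le> a" "a \<le> b" "b \<le> T" for a b
    using order_trans[OF norm_ge_zero xV[OF that]] by simp
  have key': "\<bar>\<phi> b - \<phi> a\<bar> \<le> 2 * C * \<bar>b - a\<bar> * \<bar>V b - V a\<bar>" if "a \<in> {0..T}" "b \<in> {0..T}" for a b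
  proof (cases "a \<le> b")
    case True
    then show ?thesis using key[of a b] Vmono[of a b] that by simp
  next
    case False
    then have "\<bar>V b - V a\<bar> = V a - V b" "\<bar>b - a\<bar> = a - b" using Vmono[of b a] that by auto
    then show ?thesis using key[of b a] that False by (simp add: abs_minus_commute)
  qed
  have "(\<phi> has_real_derivative 0) (at u within {0..T})" if u: "u \<in> {0..T}" for u
    unfolding has_field_derivative_iff
  proof (rule Lim_null_comparison)
    have "norm ((\<phi> y - \<phi> u) / (y - u)) \<le> 2 * C * \<bar>V y - V u\<bar>" if "y \<in> {0..T}" "y \<noteq> u" for y
      using key'[OF u that(1)] that(2) by (simp add: abs_divide pos_divide_le_eq mult_ac)
    then show "\<forall>\<^sub>F y in at u within {0..T}. norm ((\<phi> y - \<phi> u) / (y - u)) \<le> 2 * C * \<bar>V y - V u\<bar>"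
      by (simp add: eventually_at_filter)
    have "(V \<longlongrightarrow> V u) (at u within {0..T})"
      using Vcont u by (simp add: continuous_on_def)
    then have "((\<lambda>y. 2 * C * \<bar>V y - V u\<bar>) \<longlongrightarrow> 2 * C * \<bar>V u - V u\<bar>) (at u within {0..T})"
      by (intro tendsto_intros)
    then show "((\<lambda>y. 2 * C * \<bar>V y - V u\<bar>) \<longlongrightarrow> 0) (at u within {0..T})" by simp
  qed
  then obtain c where "\<forall>u\<in>{0..T}. \<phi> u = c"
    using has_field_derivative_zero_constant[of "{0..T}" \<phi>] by auto
  then have "\<phi> T = \<phi> 0" using \<open>0 \<le> T\<close> by simp
  then have "integral {0..T} q = p T \<bullet> x T - p 0 \<bullet> x 0" by (simp add: \<phi>_def)
  with qi show ?thesis unfolding q_def[symmetric] by (metis integrable_integral)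
qed

section \<open>Vectors, matrices and measurability\<close>

text \<open>The inequality holds term by term. Where \<open>y $ j\<close> is nonpositive, the crude
  constant on the left dominates the entries. Where it is positive, \<open>j\<close> differs from
  \<open>i\<close>, and the Metzler condition makes the term nonnegative. The constant sums over all
  entries so that it serves every row, as \<open>nonneg_of_cooperative\<close> demands.\<close>

lemma metzler_row_lower_bound:
  fixes A R :: "real^'n^'n"
  assumes "metzler (A - R)" and "0 \<le> R" and yi: "y $ i \<le> 0"
  shows "- (\<Sum>i\<in>UNIV. \<Sum>j\<in>UNIV. \<bar>A $ i $ j\<bar> + R $ i $ j) * (\<Sum>j\<in>UNIV. max 0 (- y $ j))
    \<le> (\<Sum>j\<in>UNIV. A $ i $ j * y $ j - R $ i $ j * \<bar>y $ j\<bar>)"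
proof -
  define c where "c = (\<Sum>i\<in>UNIV. \<Sum>j\<in>UNIV. \<bar>A $ i $ j\<bar> + R $ i $ j)"
  have R: "0 \<le> R $ k $ j" for k j using \<open>0 \<le> R\<close> by (simp add: less_eq_vec_def)
  have cij: "\<bar>A $ i $ j\<bar> + R $ i $ j \<le> c" for j
  proof -
    have "\<bar>A $ i $ j\<bar> + R $ i $ j \<le> (\<Sum>j\<in>UNIV. \<bar>A $ i $ j\<bar> + R $ i $ j)"
      by (rule member_le_sum) (auto simp: R)
    also have "\<dots> \<le> c"
      unfolding c_def by (rule member_le_sum) (auto simp: R intro!: sum_nonneg add_nonneg_nonneg)
    finally show ?thesis .
  qed
  have "- c * (\<Sum>j\<in>UNIV. max 0 (- y $ j)) = (\<Sum>j\<in>UNIV. - c * max 0 (- y $ j))"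
    by (rule sum_distrib_left)
  also have "\<dots> \<le> (\<Sum>j\<in>UNIV. A $ i $ j * y $ j - R $ i $ j * \<bar>y $ j\<bar>)"
  proof (rule sum_mono)
    fix j
    show "- c * max 0 (- y $ j) \<le> A $ i $ j * y $ j - R $ i $ j * \<bar>y $ j\<bar>"
    proof (cases "y $ j \<le> 0")
      case True
      have "(- A $ i $ j - R $ i $ j) * (- y $ j) \<ge> - c * (- y $ j)"
        by (rule mult_right_mono) (use cij[of j] True in linarith)+
      then show ?thesis using True by (simp add: max_def algebra_simps)
    next
      case False
      then have "i \<noteq> j" using yi by auto
      then have "0 \<le> (A $ i $ j - R $ i $ j) * y $ j"
        using \<open>metzler (A - R)\<close> False by (simp add: metzler_def)
      then show ?thesis using False by (simp add: max_def algebra_simps)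
    qed
  qed
  finally show ?thesis unfolding c_def .
qed

lemma abs_matrix_vector_mult_le:
  fixes M :: "real^'n^'m"
  shows "\<bar>(M *v z) $ k\<bar> \<le> (\<Sum>j\<in>UNIV. \<bar>M $ k $ j\<bar> * \<bar>z $ j\<bar>)"
  unfolding matrix_vector_mult_def by (auto intro!: order_trans[OF sum_abs] simp: abs_mult)

lemma norm_matrix_vector_mult_le:
  fixes M :: "real^'n^'m"
  shows "norm (M *v z) \<le> onorm ((*v) M) * norm z"
  by (rule onorm) (rule matrix_vector_mul_bounded_linear)

lemma norm_abs_diff_le:
  fixes x y :: "real^'n"
  shows "norm (\<bar>x\<bar> - \<bar>y\<bar>) \<le> norm (x - y)"
  by (rule norm_le_componentwise_cart) (simp add: abs_vec_def)

lemma has_vector_derivative_reflect: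
  assumes "(p has_vector_derivative d) (at (T - t) within {0..T})"
  shows "((\<lambda>t. p (T - t)) has_vector_derivative - d) (at t within {0..T})"
proof -
  have "(\<lambda>t. T - t) ` {0..T} = {0..T}" by simp
  moreover have "((\<lambda>t. T - t) has_vector_derivative - 1) (at t within {0..T})"
    by (auto intro!: derivative_eq_intros)
  ultimately show ?thesis
    using vector_diff_chain_within[of "\<lambda>t. T - t" "-1" t "{0..T}" p d] assms by (simp add: o_def)
qed

lemma borel_measurable_vecI:
  fixes f :: "'a \<Rightarrow> 'b::euclidean_space^'n"
  assumes "\<And>i. (\<lambda>x. f x $ i) \<in> borel_measurable M"
  shows "f \<in> borel_measurable M"
  unfolding borel_measurable_euclidean_space[of f]
proof
  fix b :: "'b^'n" assume "b \<in> Basis"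
  then obtain i c where "b = axis i c" by (auto simp: Basis_vec_def)
  then show "(\<lambda>x. f x \<bullet> b) \<in> borel_measurable M"
    using borel_measurable_inner[OF assms[of i] borel_measurable_const[of c]] by (simp add: inner_axis)
qed

text \<open>Components may lie in any Euclidean space, so that matrix-valued maps can be treated row
  by row.\<close>

lemma borel_measurable_vec_nthI:
  fixes f :: "'a \<Rightarrow> 'b::real_normed_vector^'n"
  assumes "f \<in> borel_measurable M"
  shows "(\<lambda>x. f x $ i) \<in> borel_measurable M"
  by (rule borel_measurable_continuous_on[OF _ assms]) (intro continuous_intros)

lemma borel_measurable_matrix_vector_mult:
  fixes K :: "'a \<Rightarrow> real^'n^'m"
  assumes "K \<in> borel_measurable M" and "x \<in> borel_measurable M"
  shows "(\<lambda>t. K t *v x t) \<in> borel_measurable M"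
  by (rule borel_measurable_vecI)
    (auto simp: matrix_vector_mult_def
      intro!: borel_measurable_sum borel_measurable_times borel_measurable_vec_nthI assms)

lemma abs_inner_vec_le:
  fixes y u e :: "real^'n"
  assumes "\<bar>u\<bar> \<le> e"
  shows "\<bar>y \<bullet> u\<bar> \<le> \<bar>y\<bar> \<bullet> e"
proof -
  have "\<bar>y $ i * u $ i\<bar> \<le> \<bar>y $ i\<bar> * e $ i" for i
    using assms by (simp add: abs_mult mult_left_mono less_eq_vec_def abs_vec_def)
  then show ?thesis
    unfolding inner_vec_def by (auto intro!: order_trans[OF sum_abs sum_mono] simp: abs_vec_def)
qed

lemma inner_nonneg_vec:
  fixes x y :: "real^'n"
  assumes "0 \<le> x" and "0 \<le> y"
  shows "0 \<le> x \<bullet> y"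
  using assms by (auto simp: inner_vec_def less_eq_vec_def intro!: sum_nonneg)

lemma matrix_vector_mult_mono:
  fixes M :: "real^'n^'m"
  assumes "0 \<le> M" and "x \<le> y"
  shows "M *v x \<le> M *v y"
  using assms by (auto simp: matrix_vector_mult_def less_eq_vec_def intro!: sum_mono mult_left_mono)

text \<open>Applied to the control and to \<open>v\<close> at a time when the state is not yet known
  to be nonnegative; hence the absolute values around \<open>N *v z\<close> and
  \<open>z\<close>.\<close>

lemma abs_matrix_vector_mult_dominated_le:
  fixes M :: "real^'k^'m" and N :: "real^'n^'k"
  assumes "0 \<le> N" and u: "\<And>k. \<bar>u $ k\<bar> \<le> \<bar>(N *v z) $ k\<bar>"
  shows "\<bar>(M *v u) $ i\<bar> \<le> (\<Sum>j\<in>UNIV. (\<bar>M\<bar> ** N) $ i $ j * \<bar>z $ j\<bar>)"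
proof -
  have "\<bar>u $ k\<bar> \<le> (\<Sum>j\<in>UNIV. N $ k $ j * \<bar>z $ j\<bar>)" for k
    using order_trans[OF u abs_matrix_vector_mult_le, of k] \<open>0 \<le> N\<close> by (simp add: less_eq_vec_def)
  then have "(\<Sum>k\<in>UNIV. \<bar>M $ i $ k\<bar> * \<bar>u $ k\<bar>) \<le> (\<Sum>k\<in>UNIV. \<bar>M $ i $ k\<bar> * (\<Sum>j\<in>UNIV. N $ k $ j * \<bar>z $ j\<bar>))"
    by (intro sum_mono mult_left_mono) auto
  also have "\<dots> = (\<Sum>j\<in>UNIV. (\<bar>M\<bar> ** N) $ i $ j * \<bar>z $ j\<bar>)"
    unfolding sum_distrib_left
    by (subst sum.swap) (simp add: matrix_matrix_mult_def abs_vec_def sum_distrib_left sum_distrib_right mult_ac)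
  finally show ?thesis using abs_matrix_vector_mult_le[of M u i] by linarith
qed

section \<open>The costate equation\<close>

context minimax_problem
begin

text \<open>It bounds, entry by entry, the joint influence of control and disturbance on the state
  velocity. The Metzler hypothesis is about \<open>A - margin\<close>.\<close>

definition margin :: "real^'n^'n" where
  "margin = \<bar>B\<bar> ** E + \<bar>H\<bar> ** G"

text \<open>The field of the costate equation in reversed time: it gives \<open>- p'\<close>, hence
  the derivative of \<open>p (T - t)\<close>.\<close>

definition costate_field :: "real^'n \<Rightarrow> real^'n" where
  "costate_field q = s + transpose A *v q - transpose E *v \<bar>r + transpose B *v q\<bar>
     + transpose G *v \<bar>- \<delta> + transpose H *v q\<bar>"

lemma margin_nonneg:
  assumes "0 \<le> E" and "0 \<le> G"
  shows "0 \<le> margin"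
  using assms
  by (auto simp: margin_def less_eq_vec_def matrix_matrix_mult_def abs_vec_def
      intro!: add_nonneg_nonneg sum_nonneg mult_nonneg_nonneg)

text \<open>Taking absolute values is 1-Lipschitz in each component, so the terms with
  \<open>E\<close> and \<open>G\<close>, whatever their signs, change by at most the transposed
  \<open>margin\<close> applied to the moduli of \<open>a - b\<close>. The left side has the form
  bounded in \<open>metzler_row_lower_bound\<close>.\<close>

lemma costate_field_diff_ge:
  assumes "0 \<le> E" and "0 \<le> G"
  shows "(\<Sum>j\<in>UNIV. transpose A $ i $ j * (a - b) $ j - transpose margin $ i $ j * \<bar>(a - b) $ j\<bar>)
    \<le> (costate_field a - costate_field b) $ i"
proof -
  have abs_part: "\<bar>(transpose N *v \<bar>e + transpose M *v a\<bar>) $ i - (transpose N *v \<bar>e + transpose M *v b\<bar>) $ i\<bar>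
      \<le> (\<Sum>j\<in>UNIV. transpose (\<bar>M\<bar> ** N) $ i $ j * \<bar>(a - b) $ j\<bar>)"
    if "0 \<le> N" for N :: "real^'n^'k" and M :: "real^'k^'n" and e :: "real^'k"
  proof -
    let ?d = "\<lambda>k. \<bar>e $ k + (transpose M *v a) $ k\<bar> - \<bar>e $ k + (transpose M *v b) $ k\<bar>"
    have N: "0 \<le> N $ k $ i" for k using that by (simp add: less_eq_vec_def)
    have "(transpose N *v \<bar>e + transpose M *v a\<bar>) $ i - (transpose N *v \<bar>e + transpose M *v b\<bar>) $ i
      = (\<Sum>k\<in>UNIV. N $ k $ i * ?d k)"
      by (simp add: matrix_vector_mult_def transpose_def abs_vec_def sum_subtractf algebra_simps
          del: transpose_matrix_vector)
    also have "\<bar>\<dots>\<bar> \<le> (\<Sum>k\<in>UNIV. N $ k $ i * (\<Sum>j\<in>UNIV. \<bar>M $ j $ k\<bar> * \<bar>(a - b) $ j\<bar>))"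
    proof (rule order_trans[OF sum_abs sum_mono])
      fix k
      have "\<bar>?d k\<bar> \<le> \<bar>(transpose M *v (a - b)) $ k\<bar>"
        by (simp add: matrix_vector_mult_diff_distrib del: transpose_matrix_vector)
      also have "\<dots> \<le> (\<Sum>j\<in>UNIV. \<bar>M $ j $ k\<bar> * \<bar>(a - b) $ j\<bar>)"
        using abs_matrix_vector_mult_le[of "transpose M" "a - b" k]
        by (simp add: transpose_def del: transpose_matrix_vector)
      finally show "\<bar>N $ k $ i * ?d k\<bar> \<le> N $ k $ i * (\<Sum>j\<in>UNIV. \<bar>M $ j $ k\<bar> * \<bar>(a - b) $ j\<bar>)"
        using N[of k] by (simp add: abs_mult mult_left_mono)
    qed
    also have "\<dots> = (\<Sum>j\<in>UNIV. transpose (\<bar>M\<bar> ** N) $ i $ j * \<bar>(a - b) $ j\<bar>)"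
      unfolding sum_distrib_left
      by (subst sum.swap) (simp add: transpose_def matrix_matrix_mult_def abs_vec_def sum_distrib_left sum_distrib_right mult_ac)
    finally show ?thesis .
  qed
  have "(transpose A *v a) $ i - (transpose A *v b) $ i = (\<Sum>j\<in>UNIV. transpose A $ i $ j * (a - b) $ j)"
    by (simp add: matrix_vector_mult_def sum_subtractf algebra_simps del: transpose_matrix_vector)
  moreover have "transpose margin $ i $ j = transpose (\<bar>B\<bar> ** E) $ i $ j + transpose (\<bar>H\<bar> ** G) $ i $ j" for j
    by (simp add: margin_def transpose_def)
  ultimately show ?thesis
    using abs_part[OF \<open>0 \<le> E\<close>, of r B] abs_part[OF \<open>0 \<le> G\<close>, of "- \<delta>" H]
    unfolding costate_field_def
    by (simp add: sum_subtractf sum.distrib distrib_right del: transpose_matrix_vector)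
qed

lemma costate_field_lipschitz:
  obtains L where "0 < L" and "\<And>a b. norm (costate_field a - costate_field b) \<le> L * norm (a - b)"
proof -
  let ?a = "onorm ((*v) (transpose A))"
  let ?be = "onorm ((*v) (transpose E)) * onorm ((*v) (transpose B))"
  let ?hg = "onorm ((*v) (transpose G)) * onorm ((*v) (transpose H))"
  have abs_part: "norm (transpose N *v (\<bar>e + transpose M *v a\<bar> - \<bar>e + transpose M *v b\<bar>))
      \<le> onorm ((*v) (transpose N)) * onorm ((*v) (transpose M)) * norm (a - b)"
    for N :: "real^'n^'k" and M :: "real^'k^'n" and e :: "real^'k" and a b :: "real^'n"
  proof -
    let ?d = "\<bar>e + transpose M *v a\<bar> - \<bar>e + transpose M *v b\<bar>"
    have "norm ?d \<le> norm (transpose M *v (a - b))"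
      using norm_abs_diff_le[of "e + transpose M *v a" "e + transpose M *v b"]
      by (simp add: matrix_vector_mult_diff_distrib del: transpose_matrix_vector)
    also have "\<dots> \<le> onorm ((*v) (transpose M)) * norm (a - b)"
      by (rule norm_matrix_vector_mult_le)
    finally have "onorm ((*v) (transpose N)) * norm ?d
      \<le> onorm ((*v) (transpose N)) * (onorm ((*v) (transpose M)) * norm (a - b))"
      by (rule mult_left_mono) (rule onorm_pos_le, rule matrix_vector_mul_bounded_linear)
    then show ?thesis
      using norm_matrix_vector_mult_le[of "transpose N" ?d] by (simp add: mult.assoc)
  qed
  have pos: "0 \<le> onorm ((*v) M)" for M :: "real^'j^'k"
    by (rule onorm_pos_le) (rule matrix_vector_mul_bounded_linear)
  show ?thesis
  proof (rule that)
    \<comment> \<open>The summand 1 makes the constant strictly positive, as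
      \<open>caratheodory_picard\<close> requires.\<close>
    show "0 < 1 + ?a + ?be + ?hg" by (intro add_pos_nonneg mult_nonneg_nonneg pos) simp
    fix a b :: "real^'n"
    have "costate_field a - costate_field b = transpose A *v (a - b)
        - transpose E *v (\<bar>r + transpose B *v a\<bar> - \<bar>r + transpose B *v b\<bar>)
        + transpose G *v (\<bar>- \<delta> + transpose H *v a\<bar> - \<bar>- \<delta> + transpose H *v b\<bar>)"
      by (simp add: costate_field_def matrix_vector_mult_diff_distrib algebra_simps del: transpose_matrix_vector)
    also have "norm \<dots> \<le> ?a * norm (a - b) + ?be * norm (a - b) + ?hg * norm (a - b)"
      by (intro norm_triangle_mono norm_triangle_le_diff add_mono abs_part norm_matrix_vector_mult_le)
    also have "\<dots> \<le> (1 + ?a + ?be + ?hg) * norm (a - b)"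
      by (simp add: algebra_simps)
    finally show "norm (costate_field a - costate_field b) \<le> (1 + ?a + ?be + ?hg) * norm (a - b)" .
  qed
qed

text \<open>Reflecting time turns the terminal condition into an initial one. Reflection is an
  involution, so the same chain rule serves both directions.\<close>

lemma solves_costate_iff_reversed:
  "solves_costate p \<longleftrightarrow>
    (\<forall>t\<in>{0..T}. ((\<lambda>t. p (T - t)) has_vector_derivative costate_field (p (T - t))) (at t within {0..T}))
    \<and> p T = 0"
proof -
  have "((\<lambda>t. p (T - t)) has_vector_derivative costate_field (p (T - t))) (at t within {0..T})"
    if "solves_costate p" "t \<in> {0..T}" for t
  proof -
    have "T - t \<in> {0..T}" using that by simp
    then have "(p has_vector_derivative - costate_field (p (T - t))) (at (T - t) within {0..T})"
      using that(1) unfolding solves_costate_def costate_field_def by blast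
    from has_vector_derivative_reflect[OF this] show ?thesis by simp
  qed
  moreover have "(p has_vector_derivative - costate_field (p t)) (at t within {0..T})"
    if "\<forall>t\<in>{0..T}. ((\<lambda>t. p (T - t)) has_vector_derivative costate_field (p (T - t))) (at t within {0..T})"
      "t \<in> {0..T}" for t
    using has_vector_derivative_reflect[of "\<lambda>t. p (T - t)" "costate_field (p t)" T t] that(1)[rule_format, of "T - t"] that(2)
    by simp
  ultimately show ?thesis
    unfolding solves_costate_def costate_field_def[symmetric] by blast
qed

lemma costate_field_continuous: "continuous_on S costate_field"
proof -
  obtain L where L: "0 < L" "\<And>a b. norm (costate_field a - costate_field b) \<le> L * norm (a - b)"
    using costate_field_lipschitz by blast
  then have "L-lipschitz_on S costate_field" by (intro lipschitz_onI) (auto simp: dist_norm)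
  then show ?thesis by (rule lipschitz_on_continuous_on)
qed

text \<open>The integral equation is solved from 0 in reversed time. Its integrand is continuous, so
  the solution is differentiable at every point and not just almost everywhere.\<close>

lemma costate_exists:
  assumes "0 \<le> T"
  obtains p where "solves_costate p"
proof -
  obtain L where L: "0 < L" "\<And>a b. norm (costate_field a - costate_field b) \<le> L * norm (a - b)"
    using costate_field_lipschitz by blast
  have cont: "continuous_on {0..T} (\<lambda>t. costate_field (q t))" if "continuous_on {0..T} q" for q
    using continuous_on_compose2[OF costate_field_continuous[of UNIV] that] by simp
  obtain q where q: "continuous_on {0..T} q"
    "\<And>t. t \<in> {0..T} \<Longrightarrow> ((\<lambda>t. costate_field (q t)) has_integral (q t - 0)) {0..t}"
    by (rule caratheodory_picard[where T = T and f = "\<lambda>t. costate_field" and L = L and ?x0.0 = 0])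
      (use L cont in \<open>auto intro: integrable_continuous_real\<close>)
  have I: "((\<lambda>t. integral {0..t} (\<lambda>t. costate_field (q t))) has_vector_derivative costate_field (q t)) (at t within {0..T})"
    if "t \<in> {0..T}" for t
    by (rule integral_has_vector_derivative[OF cont[OF q(1)] that])
  have qI: "q t = integral {0..t} (\<lambda>t. costate_field (q t))" if "t \<in> {0..T}" for t
    using q(2)[OF that] by (simp add: integral_unique)
  have D: "(q has_vector_derivative costate_field (q t)) (at t within {0..T})" if "t \<in> {0..T}" for t
    by (rule has_vector_derivative_transform[OF that qI I[OF that]])
  have "((\<lambda>t. costate_field (q t)) has_integral q 0) {0}" using q(2)[of 0] \<open>0 \<le> T\<close> by simp
  from has_integral_unique[OF this has_integral_refl(2)] have "q 0 = 0" .
  with D have "solves_costate (\<lambda>t. q (T - t))"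
    by (simp add: solves_costate_iff_reversed)
  then show ?thesis by (rule that)
qed

text \<open>The distance of two reversed solutions starts at 0 and satisfies a Gronwall inequality
  with the Lipschitz constant.\<close>

lemma solves_costate_unique:
  assumes p: "solves_costate p" and q: "solves_costate q" and t: "t \<in> {0..T}"
  shows "q t = p t"
proof -
  obtain L where L: "0 < L" "\<And>a b. norm (costate_field a - costate_field b) \<le> L * norm (a - b)"
    using costate_field_lipschitz by blast
  let ?p = "\<lambda>t. p (T - t)" and ?q = "\<lambda>t. q (T - t)"
  define \<psi> where "\<psi> = (\<lambda>t. norm (?q t - ?p t))"
  have D: "((\<lambda>t. ?q t - ?p t) has_vector_derivative costate_field (?q t) - costate_field (?p t)) (at t within {0..T})"
    if "t \<in> {0..T}" for t
    using p q that by (auto simp: solves_costate_iff_reversed intro!: has_vector_derivative_diff)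
  then have \<psi>: "continuous_on {0..T} \<psi>"
    unfolding \<psi>_def by (intro continuous_on_norm continuous_on_vector_derivative)
  have "\<psi> u \<le> L * integral {0..u} \<psi>" if u: "u \<in> {0..T}" for u
  proof -
    have i: "((\<lambda>t. costate_field (?q t) - costate_field (?p t)) has_integral
      ((?q u - ?p u) - (?q 0 - ?p 0))) {0..u}"
      by (rule fundamental_theorem_of_calculus)
        (use u in \<open>auto intro!: has_vector_derivative_within_subset[OF D]\<close>)
    have "?q 0 - ?p 0 = 0" using p q by (simp add: solves_costate_def)
    then have "\<psi> u = norm (integral {0..u} (\<lambda>t. costate_field (?q t) - costate_field (?p t)))"
      by (simp add: \<psi>_def integral_unique[OF i])
    also have "\<dots> \<le> integral {0..u} (\<lambda>t. L * \<psi> t)"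
    proof (rule integral_norm_bound_integral)
      show "(\<lambda>t. L * \<psi> t) integrable_on {0..u}"
        by (intro integrable_continuous_real continuous_intros continuous_on_subset[OF \<psi>]) (use u in auto)
    qed (use i L in \<open>auto simp: \<psi>_def\<close>)
    finally show ?thesis by simp
  qed
  then have "\<psi> (T - t) = 0"
    by (intro gronwall_zero[OF \<psi>, where c = L]) (use L(1) t in \<open>simp_all add: \<psi>_def\<close>)
  then show ?thesis by (simp add: \<psi>_def)
qed

lemma unique_costate_iff: "unique_costate p \<longleftrightarrow> solves_costate p"
  using solves_costate_unique by (auto simp: unique_costate_def)

text \<open>Reversed in time, the costate is an autonomous cooperative flow that starts at 0, where
  its field is nonnegative. It first enters the orthant and stays there; by comparison with its own
  time shift it then keeps increasing.\<close>

lemma costate_antimono: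
  assumes p: "solves_costate p"
    and EG: "0 \<le> E" "0 \<le> G"
    and metz: "metzler (A - \<bar>B\<bar> ** E - \<bar>H\<bar> ** G)"
    and s: "transpose E *v \<bar>r\<bar> - transpose G *v \<bar>\<delta>\<bar> \<le> s"
    and h: "h \<in> {0..T}"
  shows "p h \<le> p 0"
proof -
  define c where "c = (\<Sum>i\<in>UNIV. \<Sum>j\<in>UNIV. \<bar>transpose A $ i $ j\<bar> + transpose margin $ i $ j)"
  let ?q = "\<lambda>t. p (T - t)"
  have R: "0 \<le> transpose margin"
    using margin_nonneg[OF EG] by (simp add: less_eq_vec_def transpose_def)
  then have "0 \<le> c"
    unfolding c_def by (auto simp: less_eq_vec_def intro!: sum_nonneg add_nonneg_nonneg)
  have M: "metzler (transpose A - transpose margin)"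
    using metz by (simp add: metzler_def margin_def transpose_def algebra_simps)
  have low: "- c * (\<Sum>j\<in>UNIV. max 0 (- (a - b) $ j)) \<le> (costate_field a - costate_field b) $ i"
    if "(a - b) $ i \<le> 0" for a b :: "real^'n" and i
    using metzler_row_lower_bound[OF M R that] costate_field_diff_ge[OF EG, where a = a and b = b and i = i]
    unfolding c_def by linarith
  have D: "(?q has_vector_derivative costate_field (?q t)) (at t within {0..T})" if "t \<in> {0..T}" for t
    using p that by (simp add: solves_costate_iff_reversed)
  have q0: "?q 0 = 0" using p by (simp add: solves_costate_def)
  \<comment> \<open>The hypothesis on \<open>s\<close> says precisely this.\<close>
  have "0 \<le> costate_field 0"
    using s by (simp add: costate_field_def algebra_simps)
  then have field0: "0 \<le> costate_field 0 $ i" for i by (simp add: less_eq_vec_def)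
  have nonneg: "0 \<le> ?q h" if "h \<in> {0..T}" for h
  proof (rule nonneg_of_cooperative[OF _ _ \<open>0 \<le> c\<close> _ that])
    show "((\<lambda>t. costate_field (?q t)) has_integral (?q t - ?q 0)) {0..t}" if "t \<in> {0..T}" for t
      by (rule fundamental_theorem_of_calculus)
        (use that in \<open>auto intro!: has_vector_derivative_within_subset[OF D]\<close>)
    show "- c * (\<Sum>j\<in>UNIV. max 0 (- ?q t $ j)) \<le> costate_field (?q t) $ i" if "?q t $ i \<le> 0" for t i
      using low[of "?q t" 0 i] that field0[of i] by simp
  qed (use q0 in simp)
  \<comment> \<open>The shifted and the unshifted solution obey the same equation, and their
    difference starts at \<open>?q h\<close>, which is nonnegative. At time \<open>T - h\<close> the
    difference is \<open>p 0 - p h\<close>.\<close>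
  define y where "y = (\<lambda>\<tau>. ?q (\<tau> + h) - ?q \<tau>)"
  have "0 \<le> y (T - h)"
  proof (rule nonneg_of_cooperative[OF _ _ \<open>0 \<le> c\<close>])
    show "T - h \<in> {0..T - h}" using h by simp
    show "0 \<le> y 0" using nonneg[OF h] q0 by (simp add: y_def)
    have Dh: "((\<lambda>\<tau>. ?q (\<tau> + h)) has_vector_derivative costate_field (?q (\<tau> + h))) (at \<tau> within {0..T - h})"
      if "\<tau> \<in> {0..T - h}" for \<tau>
    proof -
      have "(?q has_vector_derivative costate_field (?q (\<tau> + h))) (at (\<tau> + h) within (\<lambda>\<tau>. \<tau> + h) ` {0..T - h})"
        by (rule has_vector_derivative_within_subset[OF D]) (use that h in auto)
      moreover have "((\<lambda>\<tau>. \<tau> + h) has_vector_derivative 1) (at \<tau> within {0..T - h})"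
        by (auto intro!: derivative_eq_intros)
      ultimately show ?thesis
        using vector_diff_chain_within[of "\<lambda>\<tau>. \<tau> + h" 1 \<tau> "{0..T - h}" ?q "costate_field (?q (\<tau> + h))"]
        by (simp add: o_def)
    qed
    show "((\<lambda>\<tau>. costate_field (?q (\<tau> + h)) - costate_field (?q \<tau>)) has_integral (y \<tau> - y 0)) {0..\<tau>}"
      if \<tau>: "\<tau> \<in> {0..T - h}" for \<tau>
    proof (rule fundamental_theorem_of_calculus)
      show "0 \<le> \<tau>" using \<tau> by simp
      fix u assume u: "u \<in> {0..\<tau>}"
      show "(y has_vector_derivative costate_field (?q (u + h)) - costate_field (?q u)) (at u within {0..\<tau>})"
        unfolding y_def
        by (intro has_vector_derivative_diff has_vector_derivative_within_subset[OF Dh]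
            has_vector_derivative_within_subset[OF D]) (use u \<tau> h in auto)
    qed
    show "- c * (\<Sum>j\<in>UNIV. max 0 (- y \<tau> $ j)) \<le> (costate_field (?q (\<tau> + h)) - costate_field (?q \<tau>)) $ i"
      if "y \<tau> $ i \<le> 0" for \<tau> i
      using low that unfolding y_def by blast
  qed
  then show ?thesis by (simp add: y_def)
qed

section \<open>Bounds on the cost\<close>

text \<open>The integrand left over when \<open>p \<bullet> x\<close> is differentiated along a trajectory. The first bracket
  is nonnegative for every admissible control, the second nonpositive for every admissible \<open>v\<close>.\<close>

definition defect ::
  "(real \<Rightarrow> real^'n) \<Rightarrow> (real \<Rightarrow> real^'n \<Rightarrow> real^'m) \<Rightarrow> (real \<Rightarrow> real^'l) \<Rightarrow> (real \<Rightarrow> real^'c)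
    \<Rightarrow> (real \<Rightarrow> real^'n) \<Rightarrow> real \<Rightarrow> real" where
  "defect p \<mu> w v x t =
     ((r + transpose B *v p t) \<bullet> \<mu> t (x t) + \<bar>r + transpose B *v p t\<bar> \<bullet> (E *v x t))
     + ((- \<delta> + transpose H *v p t) \<bullet> v t - \<bar>- \<delta> + transpose H *v p t\<bar> \<bullet> (G *v x t))
     + (transpose F *v p t - \<gamma>) \<bullet> w t"

lemma costate_continuous:
  assumes "solves_costate p"
  shows "continuous_on {0..T} p"
  using assms unfolding solves_costate_def by (intro continuous_on_vector_derivative) blast

text \<open>Integration by parts for \<open>p \<bullet> x\<close>, with the terminal term removed by
  \<open>p T = 0\<close>. Adding the running cost cancels the terms in \<open>s\<close> and
  \<open>A\<close>, and what remains groups into \<open>defect\<close>.\<close>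

lemma defect_has_integral:
  assumes "0 \<le> T" and p: "solves_costate p" and traj: "(w, v, x) \<in> trajectories x0 \<mu>"
  shows "(defect p \<mu> w v x has_integral (cost \<mu> (w, v, x) - p 0 \<bullet> x0)) {0..T}"
proof -
  have vel: "velocity \<mu> w v x absolutely_integrable_on {0..T}"
    and xi: "\<And>t. t \<in> {0..T} \<Longrightarrow> (velocity \<mu> w v x has_integral (x t - x0)) {0..t}"
    and rc: "running_cost \<mu> w v x absolutely_integrable_on {0..T}"
    using traj by (auto simp: trajectories_def)
  have "(velocity \<mu> w v x has_integral (x 0 - x0)) {0}" using xi[of 0] \<open>0 \<le> T\<close> by simp
  from has_integral_unique[OF this has_integral_refl(2)] have x0: "x 0 = x0" by simp
  have "continuous_on {0..T} (\<lambda>t. - costate_field (p t))"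
    using continuous_on_compose2[OF costate_field_continuous[of UNIV] costate_continuous[OF p]]
    by (intro continuous_intros) simp
  then have "((\<lambda>t. - costate_field (p t) \<bullet> x t + p t \<bullet> velocity \<mu> w v x t) has_integral
      (p T \<bullet> x T - p 0 \<bullet> x 0)) {0..T}"
    using p xi vel x0 \<open>0 \<le> T\<close>
    by (intro has_integral_inner_by_parts) (auto simp: solves_costate_def costate_field_def)
  moreover have "(running_cost \<mu> w v x has_integral cost \<mu> (w, v, x)) {0..T}"
    using rc unfolding cost_def by (auto simp: absolutely_integrable_on_def intro: integrable_integral)
  ultimately have "((\<lambda>t. (- costate_field (p t) \<bullet> x t + p t \<bullet> velocity \<mu> w v x t)
      + running_cost \<mu> w v x t) has_integral (p T \<bullet> x T - p 0 \<bullet> x 0 + cost \<mu> (w, v, x))) {0..T}"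
    by (rule has_integral_add)
  moreover have "(- costate_field (p t) \<bullet> x t + p t \<bullet> velocity \<mu> w v x t) + running_cost \<mu> w v x t
      = defect p \<mu> w v x t" for t
    by (simp add: defect_def running_cost_def velocity_def costate_field_def inner_add_left
        inner_add_right inner_diff_left inner_diff_right dot_lmul_matrix)
  moreover have "p T = 0" using p by (simp add: solves_costate_def)
  ultimately show ?thesis using x0 by simp
qed

text \<open>The fractions for which the second bracket of \<open>defect\<close> vanishes. They
  depend on time alone, so the same choice works against every policy.\<close>

definition worst_fraction :: "(real \<Rightarrow> real^'n) \<Rightarrow> real \<Rightarrow> real^'c" where
  "worst_fraction p t = (\<chi> j. sgn ((- \<delta> + transpose H *v p t) $ j))"

lemma worst_fraction_measurable:
  assumes "solves_costate p"
  shows "worst_fraction p \<in> borel_measurable (lebesgue_on {0..T})"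
proof (rule borel_measurable_vecI)
  fix j
  have "continuous_on {0..T} (\<lambda>t. (- \<delta> + transpose H *v p t) $ j)"
    by (intro continuous_intros bounded_linear.continuous_on[OF matrix_vector_mul_bounded_linear]
        costate_continuous assms)
  then have "(\<lambda>t. (- \<delta> + transpose H *v p t) $ j) \<in> borel_measurable (lebesgue_on {0..T})"
    by (rule continuous_imp_measurable_on_sets_lebesgue) simp
  from measurable_compose[OF this borel_measurable_sgn]
  show "(\<lambda>t. worst_fraction p t $ j) \<in> borel_measurable (lebesgue_on {0..T})"
    by (simp add: worst_fraction_def)
qed

text \<open>With the worst \<open>v\<close> the control bracket of \<open>defect\<close> is
  nonnegative and the \<open>v\<close> bracket is zero, so only the \<open>w\<close> term is left as
  a lower bound. The closed-loop trajectory exists by the definition of \<open>policies\<close>.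
  Taking \<open>w = 0\<close> bounds the value from below; an impulse makes it infinite.\<close>

lemma cost_ge_of_worst_fraction:
  assumes "0 \<le> T" and p: "solves_costate p" and \<mu>: "\<mu> \<in> policies x0"
    and w: "w absolutely_integrable_on {0..T}" "\<And>t. t \<in> {0..T} \<Longrightarrow> 0 \<le> w t"
    and I: "((\<lambda>t. (transpose F *v p t - \<gamma>) \<bullet> w t) has_integral I) {0..T}"
  obtains \<xi> where "\<xi> \<in> trajectories x0 \<mu>" and "p 0 \<bullet> x0 + I \<le> cost \<mu> \<xi>"
proof -
  have "\<forall>t\<in>{0..T}. \<forall>j. \<bar>worst_fraction p t $ j\<bar> \<le> 1"
    by (simp add: worst_fraction_def abs_sgn_eq)
  then obtain x where x: "(w, \<lambda>t. \<chi> j. worst_fraction p t $ j * (G *v x t) $ j, x) \<in> trajectories x0 \<mu>"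
    using \<mu> w worst_fraction_measurable[OF p] unfolding policies_def by blast
  define v where "v = (\<lambda>t. \<chi> j. worst_fraction p t $ j * (G *v x t) $ j)"
  have traj: "(w, v, x) \<in> trajectories x0 \<mu>" using x by (simp add: v_def)
  have "I \<le> cost \<mu> (w, v, x) - p 0 \<bullet> x0"
  proof (rule has_integral_le[OF I defect_has_integral[OF \<open>0 \<le> T\<close> p traj]])
    fix t assume t: "t \<in> {0..T}"
    then have "\<bar>\<mu> t (x t)\<bar> \<le> E *v x t" using traj by (simp add: trajectories_def)
    then have "0 \<le> (r + transpose B *v p t) \<bullet> \<mu> t (x t) + \<bar>r + transpose B *v p t\<bar> \<bullet> (E *v x t)"
      using abs_inner_vec_le[of "\<mu> t (x t)" "E *v x t" "r + transpose B *v p t"] by linarith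
    moreover have "(- \<delta> + transpose H *v p t) \<bullet> v t = \<bar>- \<delta> + transpose H *v p t\<bar> \<bullet> (G *v x t)"
      unfolding inner_vec_def v_def worst_fraction_def
      by (intro sum.cong refl) (simp add: abs_vec_def abs_sgn del: transpose_matrix_vector)
    ultimately show "(transpose F *v p t - \<gamma>) \<bullet> w t \<le> defect p \<mu> w v x t"
      unfolding defect_def by linarith
  qed
  then show ?thesis using that[OF traj] by linarith
qed

text \<open>The set-valued signum matters only through these properties, which hold for any choice
  where its argument is zero. The scalar does not depend on \<open>z\<close>.\<close>

lemma optimal_gain_apply:
  assumes "optimal_gain p K" and "t \<in> {0..T}"
  obtains \<sigma> where "\<bar>\<sigma>\<bar> \<le> 1"
    and "\<sigma> * (r + transpose B *v p t) $ i = \<bar>(r + transpose B *v p t) $ i\<bar>"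
    and "\<And>z. (K t *v z) $ i = \<sigma> * (E *v z) $ i"
proof -
  have y: "(r + transpose B *v p t) $ i = r $ i + p t \<bullet> column i B"
    by (simp add: matrix_vector_mult_def transpose_def column_def inner_vec_def mult.commute
        del: transpose_matrix_vector)
  obtain \<sigma> where \<sigma>: "\<sigma> \<in> sign_set (r $ i + p t \<bullet> column i B)" "row i (K t) = \<sigma> *\<^sub>R row i E"
    using assms unfolding optimal_gain_def by blast
  show ?thesis
  proof (rule that)
    show "\<bar>\<sigma>\<bar> \<le> 1" "\<sigma> * (r + transpose B *v p t) $ i = \<bar>(r + transpose B *v p t) $ i\<bar>"
      using \<sigma>(1) unfolding y sign_set_def by (auto split: if_splits)
    show "(K t *v z) $ i = \<sigma> * (E *v z) $ i" for z
      using \<sigma>(2) by (simp add: matrix_vector_mul_component row_def vec_nth_inverse)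
  qed
qed

text \<open>Under such a gain the control bracket of \<open>defect\<close> vanishes, while the terms
  in \<open>v\<close> and \<open>w\<close> are at most 0.\<close>

lemma cost_le_of_optimal_gain:
  assumes "0 \<le> T" and p: "solves_costate p" and K: "optimal_gain p K"
    and \<gamma>: "\<And>t. t \<in> {0..T} \<Longrightarrow> transpose F *v p t \<le> \<gamma>"
    and \<xi>: "\<xi> \<in> trajectories x0 (\<lambda>t x. - (K t *v x))"
  shows "cost (\<lambda>t x. - (K t *v x)) \<xi> \<le> p 0 \<bullet> x0"
proof -
  obtain w v x where [simp]: "\<xi> = (w, v, x)" by (cases \<xi>)
  let ?\<mu> = "\<lambda>t x. - (K t *v x)"
  have traj: "(w, v, x) \<in> trajectories x0 ?\<mu>" using \<xi> by simp
  have "cost ?\<mu> (w, v, x) - p 0 \<bullet> x0 \<le> 0"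
  proof (rule has_integral_le[OF defect_has_integral[OF \<open>0 \<le> T\<close> p traj] has_integral_0])
    fix t assume t: "t \<in> {0..T}"
    have "(r + transpose B *v p t) $ i * (K t *v x t) $ i
      = \<bar>(r + transpose B *v p t) $ i\<bar> * (E *v x t) $ i" for i
    proof -
      obtain \<sigma> where \<sigma>: "\<sigma> * (r + transpose B *v p t) $ i = \<bar>(r + transpose B *v p t) $ i\<bar>"
        "\<And>z. (K t *v z) $ i = \<sigma> * (E *v z) $ i"
        using optimal_gain_apply[OF K t, of i] by blast
      show ?thesis unfolding \<sigma>(1)[symmetric] \<sigma>(2) by (rule mult.left_commute[THEN trans]) (rule mult.assoc[symmetric])
    qed
    then have "(r + transpose B *v p t) \<bullet> (K t *v x t) = \<bar>r + transpose B *v p t\<bar> \<bullet> (E *v x t)"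
      unfolding inner_vec_def by (intro sum.cong refl) (simp add: abs_vec_def del: transpose_matrix_vector)
    moreover have "\<bar>v t\<bar> \<le> G *v x t" "0 \<le> w t" using traj t by (auto simp: trajectories_def)
    moreover from this have "(- \<delta> + transpose H *v p t) \<bullet> v t \<le> \<bar>- \<delta> + transpose H *v p t\<bar> \<bullet> (G *v x t)"
      using abs_inner_vec_le[of "v t" "G *v x t" "- \<delta> + transpose H *v p t"] by linarith
    moreover have "0 \<le> (\<gamma> - transpose F *v p t) \<bullet> w t"
      by (rule inner_nonneg_vec) (use \<gamma>[OF t] \<open>0 \<le> w t\<close> in simp_all)
    ultimately show "defect p ?\<mu> w v x t \<le> 0"
      unfolding defect_def by (simp add: inner_diff_left del: transpose_matrix_vector)
  qed
  then show ?thesis by simp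
qed

text \<open>\<open>sgn\<close>, with value 0 at 0, selects from the set-valued signum, and its
  composition with a continuous function is measurable.\<close>

lemma optimal_gain_exists:
  assumes p: "solves_costate p"
  shows "\<exists>K. optimal_gain p K"
proof -
  define K :: "real \<Rightarrow> real^'n^'m"
    where "K = (\<lambda>t. \<chi> i. sgn (r $ i + p t \<bullet> column i B) *\<^sub>R E $ i)"
  have "(\<lambda>t. sgn (r $ i + p t \<bullet> column i B)) \<in> borel_measurable (lebesgue_on {0..T})" for i
  proof -
    have "continuous_on {0..T} (\<lambda>t. r $ i + p t \<bullet> column i B)"
      by (intro continuous_intros costate_continuous p)
    then have "(\<lambda>t. r $ i + p t \<bullet> column i B) \<in> borel_measurable (lebesgue_on {0..T})"
      by (rule continuous_imp_measurable_on_sets_lebesgue) simp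
    from measurable_compose[OF this borel_measurable_sgn] show ?thesis .
  qed
  then have "K \<in> borel_measurable (lebesgue_on {0..T})"
    by (intro borel_measurable_vecI) (simp add: K_def)
  moreover have "\<exists>\<sigma>\<in>sign_set (r $ i + p t \<bullet> column i B). row i (K t) = \<sigma> *\<^sub>R row i E" for t i
    by (rule bexI[of _ "sgn (r $ i + p t \<bullet> column i B)"])
      (auto simp: sign_set_def K_def row_def vec_eq_iff sgn_if)
  ultimately show ?thesis unfolding optimal_gain_def by blast
qed

section \<open>The value of the problem\<close>

lemma optimal_gain_abs_le:
  assumes "optimal_gain p K" and "t \<in> {0..T}"
  shows "\<bar>(K t *v z) $ i\<bar> \<le> \<bar>(E *v z) $ i\<bar>"
proof -
  obtain \<sigma> where "\<bar>\<sigma>\<bar> \<le> 1" "\<And>z. (K t *v z) $ i = \<sigma> * (E *v z) $ i"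
    using optimal_gain_apply[OF assms, of i] by blast
  then show ?thesis by (simp add: abs_mult mult_left_le_one_le)
qed

text \<open>For given \<open>w\<close> and \<open>d\<close> the closed loop is affine in the state,
  with bounded measurable coefficients and an integrable forcing term. It thus has a solution on all
  of \<open>{0..T}\<close>, and the constraints follow once that solution is known to be
  nonnegative.\<close>

lemma optimal_gain_mem_policies:
  assumes "0 \<le> T" and F: "0 \<le> F" and E: "0 \<le> E" and G: "0 \<le> G"
    and metz: "metzler (A - \<bar>B\<bar> ** E - \<bar>H\<bar> ** G)"
    and K: "optimal_gain p K" and "0 \<le> x0"
  shows "(\<lambda>t x. - (K t *v x)) \<in> policies x0"
proof -
  let ?\<mu> = "\<lambda>t x. - (K t *v x)"
  have u_bound: "\<bar>?\<mu> t z\<bar> \<le> E *v z" if "t \<in> {0..T}" "0 \<le> z" for t z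
  proof -
    have "0 \<le> E *v z" using matrix_vector_mult_mono[OF E that(2)] by simp
    then show ?thesis
      using optimal_gain_abs_le[OF K that(1), of z] by (simp add: less_eq_vec_def abs_vec_def)
  qed
  moreover have "\<exists>x. (w, \<lambda>t. \<chi> j. d t $ j * (G *v x t) $ j, x) \<in> trajectories x0 ?\<mu>"
    if w: "w absolutely_integrable_on {0..T}" "\<forall>t\<in>{0..T}. 0 \<le> w t"
      and d: "d \<in> borel_measurable (lebesgue_on {0..T})" "\<forall>t\<in>{0..T}. \<forall>j. \<bar>d t $ j\<bar> \<le> 1"
    for w d
  proof -
    define V :: "real \<Rightarrow> real^'n \<Rightarrow> real^'c" where "V = (\<lambda>t z. \<chi> j. d t $ j * (G *v z) $ j)"
    define f where "f = (\<lambda>t z. A *v z + B *v (- (K t *v z)) + F *v w t + H *v V t z)"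
    have V_le: "\<bar>V t z $ j\<bar> \<le> \<bar>(G *v z) $ j\<bar>" if "t \<in> {0..T}" for t z j
      using d(2) that by (simp add: V_def abs_mult mult_left_le_one_le)
    have V_norm: "norm (V t z) \<le> norm (G *v z)" if "t \<in> {0..T}" for t z
      by (rule norm_le_componentwise_cart) (use V_le[OF that] in simp)
    have K_norm: "norm (K t *v z) \<le> norm (E *v z)" if "t \<in> {0..T}" for t z
      by (rule norm_le_componentwise_cart) (simp add: optimal_gain_abs_le[OF K that])
    have mult_cont: "continuous_on {0..T} (\<lambda>t. M *v x t)" if "continuous_on {0..T} x"
      for M :: "real^'n^'k" and x
      by (rule bounded_linear.continuous_on[OF matrix_vector_mul_bounded_linear that])
    have mult_meas: "(\<lambda>t. M *v x t) \<in> borel_measurable (lebesgue_on {0..T})" if "continuous_on {0..T} x"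
      for M :: "real^'n^'k" and x
      by (rule continuous_imp_measurable_on_sets_lebesgue[OF mult_cont[OF that]]) simp
    have mult_ai: "(\<lambda>t. M *v y t) absolutely_integrable_on {0..T}" if "y absolutely_integrable_on {0..T}"
      for M :: "real^'j^'k" and y
      using absolutely_integrable_linear[OF that matrix_vector_mul_bounded_linear[of M]] by (simp add: o_def)
    have x_ai: "x absolutely_integrable_on {0..T}" if "continuous_on {0..T} x" for x :: "real \<Rightarrow> real^'n"
      by (rule absolutely_integrable_continuous_real[OF that])
    have K_ai: "(\<lambda>t. - (K t *v x t)) absolutely_integrable_on {0..T}" if "continuous_on {0..T} x" for x
    proof (rule measurable_bounded_by_integrable_imp_absolutely_integrable)
      have "K \<in> borel_measurable (lebesgue_on {0..T})" using K by (simp add: optimal_gain_def)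
      moreover have "x \<in> borel_measurable (lebesgue_on {0..T})"
        by (rule continuous_imp_measurable_on_sets_lebesgue[OF that]) simp
      ultimately show "(\<lambda>t. - (K t *v x t)) \<in> borel_measurable (lebesgue_on {0..T})"
        by (intro borel_measurable_uminus borel_measurable_matrix_vector_mult)
      show "(\<lambda>t. norm (E *v x t)) integrable_on {0..T}"
        by (intro integrable_continuous_real continuous_on_norm mult_cont that)
    qed (auto simp: K_norm)
    have V_ai: "(\<lambda>t. V t (x t)) absolutely_integrable_on {0..T}" if "continuous_on {0..T} x" for x
    proof (rule measurable_bounded_by_integrable_imp_absolutely_integrable)
      show "(\<lambda>t. V t (x t)) \<in> borel_measurable (lebesgue_on {0..T})"
        unfolding V_def
        by (rule borel_measurable_vecI)
          (simp add: borel_measurable_times borel_measurable_vec_nthI d(1) mult_meas[OF that])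
      show "(\<lambda>t. norm (G *v x t)) integrable_on {0..T}"
        by (intro integrable_continuous_real continuous_on_norm mult_cont that)
    qed (auto simp: V_norm)
    have f_ai: "(\<lambda>t. f t (x t)) absolutely_integrable_on {0..T}" if "continuous_on {0..T} x" for x
      unfolding f_def by (intro set_integral_add mult_ai K_ai V_ai x_ai w(1) that)
    define L where "L = 1 + onorm ((*v) A) + onorm ((*v) B) * onorm ((*v) E) + onorm ((*v) H) * onorm ((*v) G)"
    have onorm_nonneg: "0 \<le> onorm ((*v) M)" for M :: "real^'j^'k"
      by (rule onorm_pos_le) (rule matrix_vector_mul_bounded_linear)
    have "0 < L"
      unfolding L_def by (intro add_pos_nonneg mult_nonneg_nonneg onorm_nonneg) simp
    have f_lip: "norm (f t x - f t y) \<le> L * norm (x - y)" if t: "t \<in> {0..T}" for t x y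
    proof -
      define z where "z = x - y"
      \<comment> \<open>By linearity in the state, the forcing term drops out and only the linear
        part at \<open>z\<close> remains, whose inputs are dominated in norm by
        \<open>E *v z\<close> and \<open>G *v z\<close>.\<close>
      have "V t (x - y) = V t x - V t y"
        by (simp add: V_def vec_eq_iff matrix_vector_mult_diff_distrib right_diff_distrib)
      then have "f t x - f t y = A *v z - B *v (K t *v z) + H *v V t z"
        by (simp add: f_def z_def matrix_vector_mult_diff_distrib linear_neg[OF matrix_vector_mul_linear])
      also have "norm \<dots> \<le> onorm ((*v) A) * norm z + onorm ((*v) B) * (onorm ((*v) E) * norm z)
          + onorm ((*v) H) * (onorm ((*v) G) * norm z)"
      proof (intro norm_triangle_mono norm_triangle_le_diff add_mono)
        show "norm (B *v (K t *v z)) \<le> onorm ((*v) B) * (onorm ((*v) E) * norm z)"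
          by (rule order_trans[OF norm_matrix_vector_mult_le mult_left_mono[OF
                order_trans[OF K_norm[OF t] norm_matrix_vector_mult_le] onorm_nonneg]])
        show "norm (H *v V t z) \<le> onorm ((*v) H) * (onorm ((*v) G) * norm z)"
          by (rule order_trans[OF norm_matrix_vector_mult_le mult_left_mono[OF
                order_trans[OF V_norm[OF t] norm_matrix_vector_mult_le] onorm_nonneg]])
      qed (rule norm_matrix_vector_mult_le)
      also have "\<dots> \<le> L * norm z" by (simp add: L_def algebra_simps)
      finally show ?thesis by (simp add: z_def)
    qed
    obtain x where x: "continuous_on {0..T} x"
      "\<And>t. t \<in> {0..T} \<Longrightarrow> ((\<lambda>t. f t (x t)) has_integral (x t - x0)) {0..t}"
    proof (rule caratheodory_picard[of T f L x0])
      show "(\<lambda>t. f t (x t)) integrable_on {0..T}" if "continuous_on {0..T} x" for x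
        using f_ai[OF that] by (simp add: absolutely_integrable_on_def)
    qed (use f_lip \<open>0 < L\<close> in auto)
    have "((\<lambda>t. f t (x t)) has_integral (x 0 - x0)) {0}" using x(2)[of 0] \<open>0 \<le> T\<close> by simp
    from has_integral_unique[OF this has_integral_refl(2)] have x_init: "x 0 = x0" by simp
    define c where "c = (\<Sum>i\<in>UNIV. \<Sum>j\<in>UNIV. \<bar>A $ i $ j\<bar> + margin $ i $ j)"
    have margin: "0 \<le> margin" using margin_nonneg[OF E G] .
    then have "0 \<le> c"
      unfolding c_def by (auto simp: less_eq_vec_def intro!: sum_nonneg add_nonneg_nonneg)
    have M: "metzler (A - margin)"
      using metz by (simp add: margin_def algebra_simps)
    \<comment> \<open>Even outside the orthant the inputs are bounded by the moduli of
      \<open>E *v x t\<close> and \<open>G *v x t\<close>, so \<open>margin\<close> controls them,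
      while \<open>F *v w t\<close> can only raise a component. This yields the cooperative bound
      before any state constraint is known.\<close>
    have x_nonneg: "0 \<le> x t" if t: "t \<in> {0..T}" for t
    proof (rule nonneg_of_cooperative[OF _ _ \<open>0 \<le> c\<close> _ t])
      show "((\<lambda>t. f t (x t)) has_integral x t - x 0) {0..t}" if "t \<in> {0..T}" for t
        using x(2)[OF that] x_init by simp
      show "0 \<le> x 0" using \<open>0 \<le> x0\<close> x_init by simp
      fix t i assume t: "t \<in> {0..T}" and xi: "x t $ i \<le> 0"
      have "\<bar>(B *v (- (K t *v x t))) $ i\<bar> \<le> (\<Sum>j\<in>UNIV. (\<bar>B\<bar> ** E) $ i $ j * \<bar>x t $ j\<bar>)"
        by (rule abs_matrix_vector_mult_dominated_le[OF E]) (simp add: optimal_gain_abs_le[OF K t])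
      moreover have "\<bar>(H *v V t (x t)) $ i\<bar> \<le> (\<Sum>j\<in>UNIV. (\<bar>H\<bar> ** G) $ i $ j * \<bar>x t $ j\<bar>)"
        by (rule abs_matrix_vector_mult_dominated_le[OF G]) (rule V_le[OF t])
      moreover have "0 \<le> (F *v w t) $ i"
      proof -
        have "0 \<le> w t" using w(2) t by blast
        from matrix_vector_mult_mono[OF F this] show ?thesis by (simp add: less_eq_vec_def)
      qed
      ultimately have "(A *v x t) $ i - (\<Sum>j\<in>UNIV. margin $ i $ j * \<bar>x t $ j\<bar>) \<le> f t (x t) $ i"
        by (simp add: f_def margin_def distrib_right sum.distrib)
      then have "(\<Sum>j\<in>UNIV. A $ i $ j * x t $ j - margin $ i $ j * \<bar>x t $ j\<bar>) \<le> f t (x t) $ i"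
        by (simp add: sum_subtractf matrix_vector_mult_def)
      with metzler_row_lower_bound[OF M margin xi]
      show "- c * (\<Sum>j\<in>UNIV. max 0 (- x t $ j)) \<le> f t (x t) $ i"
        unfolding c_def by linarith
    qed
    have v_bound: "\<bar>V t (x t)\<bar> \<le> G *v x t" if t: "t \<in> {0..T}" for t
    proof -
      have "0 \<le> G *v x t" using matrix_vector_mult_mono[OF G x_nonneg[OF t]] by simp
      then show ?thesis
        using V_le[OF t, of "x t"] by (simp add: less_eq_vec_def abs_vec_def)
    qed
    have "running_cost ?\<mu> w (\<lambda>t. V t (x t)) x absolutely_integrable_on {0..T}"
    proof -
      have inner_ai: "(\<lambda>t. a \<bullet> y t) absolutely_integrable_on {0..T}"
        if "y absolutely_integrable_on {0..T}" for a :: "real^'k" and y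
        using absolutely_integrable_component[OF that, of a] by (simp add: inner_commute)
      show ?thesis
        unfolding running_cost_def
        by (intro set_integral_diff set_integral_add inner_ai K_ai V_ai x_ai w(1) x(1))
    qed
    moreover have "velocity ?\<mu> w (\<lambda>t. V t (x t)) x = (\<lambda>t. f t (x t))"
      by (simp add: fun_eq_iff velocity_def f_def)
    ultimately have "(w, \<lambda>t. V t (x t), x) \<in> trajectories x0 ?\<mu>"
      using f_ai[OF x(1)] x(2) u_bound x_nonneg v_bound w(2) by (simp add: trajectories_def)
    then show ?thesis by (auto simp: V_def)
  qed
  ultimately show ?thesis unfolding policies_def by blast
qed

text \<open>The adversary can always play \<open>w = 0\<close> together with the worst
  fractions.\<close>

lemma optimal_value_ge_costate:
  assumes "0 \<le> T" and p: "solves_costate p"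
  shows "ereal (p 0 \<bullet> x0) \<le> optimal_value x0"
  unfolding optimal_value_def
proof (rule INF_greatest)
  fix \<mu> assume \<mu>: "\<mu> \<in> policies x0"
  obtain \<xi> where \<xi>: "\<xi> \<in> trajectories x0 \<mu>" "p 0 \<bullet> x0 + 0 \<le> cost \<mu> \<xi>"
    by (rule cost_ge_of_worst_fraction[OF \<open>0 \<le> T\<close> p \<mu>, of "\<lambda>_. 0" 0]) auto
  then have "ereal (p 0 \<bullet> x0) \<le> ereal (cost \<mu> \<xi>)" by simp
  also have "\<dots> \<le> worst_case_cost x0 \<mu>"
    unfolding worst_case_cost_def by (rule SUP_upper[OF \<xi>(1)])
  finally show "ereal (p 0 \<bullet> x0) \<le> worst_case_cost x0 \<mu>" .
qed

text \<open>An impulse of mass \<open>M\<close> in the offending component of \<open>w\<close>, smeared over a short initial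
  interval, gains a fixed multiple of \<open>M\<close> against every policy.\<close>

lemma optimal_value_infinite:
  assumes "0 \<le> T" and "0 \<le> \<gamma>" and p: "solves_costate p" and viol: "\<not> transpose F *v p 0 \<le> \<gamma>"
  shows "optimal_value x0 = \<infinity>"
proof -
  obtain k where k: "\<gamma> $ k < (transpose F *v p 0) $ k"
    using viol by (auto simp: less_eq_vec_def not_le)
  \<comment> \<open>For \<open>T = 0\<close> the terminal condition gives \<open>p 0 = 0\<close>,
    which cannot violate the inequality because \<open>\<gamma>\<close> is nonnegative.\<close>
  have "T \<noteq> 0"
  proof
    assume "T = 0"
    moreover have "p T = 0" using p by (simp add: solves_costate_def)
    ultimately have "p 0 = 0" by simp
    then show False using k \<open>0 \<le> \<gamma>\<close> by (simp add: less_eq_vec_def not_less[symmetric])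
  qed
  with \<open>0 \<le> T\<close> have "0 < T" by simp
  define h where "h = (\<lambda>t. (transpose F *v p t - \<gamma>) $ k)"
  \<comment> \<open>By continuity at least half of the initial violation persists on a short
    interval \<open>{0..\<epsilon>}\<close>.\<close>
  define \<eta> where "\<eta> = h 0 / 2"
  have "0 < \<eta>" using k by (simp add: \<eta>_def h_def)
  have "continuous_on {0..T} h"
    unfolding h_def
    by (intro continuous_intros bounded_linear.continuous_on[OF matrix_vector_mul_bounded_linear]
        costate_continuous p)
  then obtain e where e: "0 < e" "\<And>t. t \<in> {0..T} \<Longrightarrow> dist t 0 < e \<Longrightarrow> dist (h t) (h 0) < \<eta>"
    using \<open>0 < T\<close> \<open>0 < \<eta>\<close> unfolding continuous_on_iff by (metis atLeastAtMost_iff less_imp_le order_refl)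
  define \<epsilon> where "\<epsilon> = min T (e / 2)"
  have \<epsilon>: "0 < \<epsilon>" "\<epsilon> \<le> T" "\<epsilon> < e" using \<open>0 < T\<close> \<open>0 < e\<close> by (auto simp: \<epsilon>_def)
  have h_ge: "\<eta> \<le> h t" if "t \<in> {0..\<epsilon>}" for t
  proof -
    have "\<bar>h t - h 0\<bar> < h 0 / 2"
      using e(2)[of t] that \<epsilon> by (simp add: \<eta>_def dist_real_def)
    then show ?thesis unfolding \<eta>_def by linarith
  qed
  have "worst_case_cost x0 \<mu> = \<infinity>" if \<mu>: "\<mu> \<in> policies x0" for \<mu>
  proof (rule ereal_top)
    fix C :: real
    \<comment> \<open>The impulse gains at least \<open>M * \<eta> * \<epsilon>\<close>, so this
      \<open>M\<close> lifts the cost to \<open>C\<close>. The maximum with 0 keeps \<open>w\<close>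
      nonnegative.\<close>
    define M where "M = max 0 ((C - p 0 \<bullet> x0) / (\<eta> * \<epsilon>))"
    have M: "0 \<le> M" "C \<le> p 0 \<bullet> x0 + M * \<eta> * \<epsilon>"
    proof -
      have "(C - p 0 \<bullet> x0) / (\<eta> * \<epsilon>) \<le> M" by (simp add: M_def)
      then show "C \<le> p 0 \<bullet> x0 + M * \<eta> * \<epsilon>"
        using \<open>0 < \<eta>\<close> \<epsilon>(1) by (simp add: pos_divide_le_eq mult.assoc)
    qed (simp add: M_def)
    define w :: "real \<Rightarrow> real^'l" where "w = (\<lambda>t. if t \<in> {0..\<epsilon>} then axis k M else 0)"
    have w: "w absolutely_integrable_on {0..T}"
    proof -
      have "(\<lambda>t. axis k M :: real^'l) absolutely_integrable_on {0..\<epsilon>}"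
        by (simp add: absolutely_integrable_continuous_real)
      moreover have "indicator {0..T} t *\<^sub>R w t = indicator {0..\<epsilon>} t *\<^sub>R axis k M" for t
        using \<epsilon>(2) by (auto simp: w_def indicator_def)
      ultimately show ?thesis by (simp add: set_integrable_def)
    qed
    have Mh: "(\<lambda>t. M * h t) integrable_on {0..\<epsilon>}"
      by (intro integrable_continuous_real continuous_intros continuous_on_subset[OF \<open>continuous_on {0..T} h\<close>])
        (use \<epsilon> in auto)
    have "((\<lambda>t. if t \<in> {0..\<epsilon>} then M * h t else 0) has_integral integral {0..\<epsilon>} (\<lambda>t. M * h t)) {0..T}"
      by (subst has_integral_restrict) (use \<epsilon> integrable_integral[OF Mh] in auto)
    moreover have "(transpose F *v p t - \<gamma>) \<bullet> w t = (if t \<in> {0..\<epsilon>} then M * h t else 0)" for t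
      by (simp add: w_def h_def inner_axis mult.commute)
    ultimately have I: "((\<lambda>t. (transpose F *v p t - \<gamma>) \<bullet> w t) has_integral integral {0..\<epsilon>} (\<lambda>t. M * h t)) {0..T}"
      by presburger
    have "integral {0..\<epsilon>} (\<lambda>t. M * \<eta>) \<le> integral {0..\<epsilon>} (\<lambda>t. M * h t)"
      by (rule integral_le) (use Mh h_ge M(1) in \<open>auto intro: mult_left_mono\<close>)
    then have I_ge: "M * \<eta> * \<epsilon> \<le> integral {0..\<epsilon>} (\<lambda>t. M * h t)"
      using \<epsilon> by (simp add: mult_ac)
    obtain \<xi> where \<xi>: "\<xi> \<in> trajectories x0 \<mu>" "p 0 \<bullet> x0 + integral {0..\<epsilon>} (\<lambda>t. M * h t) \<le> cost \<mu> \<xi>"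
      by (rule cost_ge_of_worst_fraction[OF \<open>0 \<le> T\<close> p \<mu> w _ I])
        (auto simp: w_def less_eq_vec_def axis_def M(1))
    have "ereal C \<le> ereal (cost \<mu> \<xi>)" using \<xi>(2) M(2) I_ge by simp
    also have "\<dots> \<le> worst_case_cost x0 \<mu>"
      unfolding worst_case_cost_def by (rule SUP_upper[OF \<xi>(1)])
    finally show "ereal C \<le> worst_case_cost x0 \<mu>" .
  qed
  then show ?thesis unfolding optimal_value_def by (simp add: top_ereal_def INF_eqI)
qed

lemma optimal_gain_optimal:
  assumes "0 \<le> T" and "0 \<le> F" and E: "0 \<le> E" and G: "0 \<le> G"
    and metz: "metzler (A - \<bar>B\<bar> ** E - \<bar>H\<bar> ** G)"
    and s: "transpose E *v \<bar>r\<bar> - transpose G *v \<bar>\<delta>\<bar> \<le> s"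
    and p: "solves_costate p" and p0: "transpose F *v p 0 \<le> \<gamma>"
    and K: "optimal_gain p K" and "0 \<le> x0"
  shows "optimal_policy x0 (\<lambda>t x. - (K t *v x))" and "optimal_value x0 = ereal (p 0 \<bullet> x0)"
proof -
  let ?\<mu> = "\<lambda>t x. - (K t *v x)"
  have \<mu>: "?\<mu> \<in> policies x0"
    by (rule optimal_gain_mem_policies) fact+
  \<comment> \<open>Monotonicity of the costate carries the condition at time 0 over to all
    times.\<close>
  have \<gamma>: "transpose F *v p t \<le> \<gamma>" if "t \<in> {0..T}" for t
  proof -
    have "0 \<le> transpose F" using \<open>0 \<le> F\<close> by (simp add: less_eq_vec_def transpose_def)
    from order_trans[OF matrix_vector_mult_mono[OF this costate_antimono[OF p E G metz s that]] p0]
    show ?thesis .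
  qed
  have le: "worst_case_cost x0 ?\<mu> \<le> ereal (p 0 \<bullet> x0)"
    unfolding worst_case_cost_def
    by (rule SUP_least) (use cost_le_of_optimal_gain[OF \<open>0 \<le> T\<close> p K \<gamma>] in simp)
  \<comment> \<open>The cost along this trajectory is caught between the lower bound and the worst
    case, which is at most \<open>p 0 \<bullet> x0\<close>. All are therefore equal, and the
    supremum is attained.\<close>
  obtain \<xi> where \<xi>: "\<xi> \<in> trajectories x0 ?\<mu>" "p 0 \<bullet> x0 + 0 \<le> cost ?\<mu> \<xi>"
    by (rule cost_ge_of_worst_fraction[OF \<open>0 \<le> T\<close> p \<mu>, of "\<lambda>_. 0" 0]) auto
  have "ereal (cost ?\<mu> \<xi>) \<le> worst_case_cost x0 ?\<mu>"
    unfolding worst_case_cost_def by (rule SUP_upper[OF \<xi>(1)])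
  moreover have "ereal (p 0 \<bullet> x0) \<le> ereal (cost ?\<mu> \<xi>)" using \<xi>(2) by simp
  ultimately have attained: "ereal (cost ?\<mu> \<xi>) = worst_case_cost x0 ?\<mu>"
    and eq: "worst_case_cost x0 ?\<mu> = ereal (p 0 \<bullet> x0)"
    using le by (meson order.antisym order.trans)+
  have "optimal_value x0 \<le> worst_case_cost x0 ?\<mu>"
    unfolding optimal_value_def by (rule INF_lower[OF \<mu>])
  then show v: "optimal_value x0 = ereal (p 0 \<bullet> x0)"
    using optimal_value_ge_costate[OF \<open>0 \<le> T\<close> p, of x0] eq by simp
  show "optimal_policy x0 ?\<mu>"
    unfolding optimal_policy_def using \<mu> eq v attained \<xi>(1) by auto
qed

end

theorem theorem1:
  fixes T :: real
    and A :: "real^'n^'n" and B :: "real^'m^'n"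
    and F :: "real^'l^'n" and H :: "real^'c^'n"
    and E :: "real^'n^'m" and G :: "real^'n^'c"
    and s :: "real^'n" and r :: "real^'m"
    and \<gamma> :: "real^'l" and \<delta> :: "real^'c"
  assumes "0 \<le> T"
    and "0 \<le> F" and "0 \<le> E" and "0 \<le> G" and "0 \<le> \<gamma>"
    and "\<And>i. row i E \<noteq> 0"
    and "metzler (A - \<bar>B\<bar> ** E - \<bar>H\<bar> ** G)"
    and "transpose E *v \<bar>r\<bar> - transpose G *v \<bar>\<delta>\<bar> \<le> s"
  shows
    "((\<forall>x0\<ge>0. \<bar>minimax_problem.optimal_value T A B F H E G s r \<gamma> \<delta> x0\<bar> \<noteq> \<infinity>)
      \<longleftrightarrow> (\<exists>p. minimax_problem.unique_costate T A B H E G s r \<delta> p \<and> transpose F *v p 0 \<le> \<gamma>))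
     \<and> (\<forall>p. minimax_problem.unique_costate T A B H E G s r \<delta> p \<and> transpose F *v p 0 \<le> \<gamma> \<longrightarrow>
          (\<forall>x0\<ge>0. minimax_problem.optimal_value T A B F H E G s r \<gamma> \<delta> x0 = ereal (p 0 \<bullet> x0)) \<and>
          (\<exists>K. minimax_problem.optimal_gain T B E r p K) \<and>
          (\<forall>K. minimax_problem.optimal_gain T B E r p K \<longrightarrow>
             (\<forall>x0\<ge>0. minimax_problem.optimal_policy T A B F H E G s r \<gamma> \<delta> x0
                        (\<lambda>t x. - (K t *v x)))))"
proof -
  interpret minimax_problem T A B F H E G s r \<gamma> \<delta> .
  note data = \<open>0 \<le> T\<close> \<open>0 \<le> F\<close> \<open>0 \<le> E\<close> \<open>0 \<le> G\<close>
    \<open>metzler (A - \<bar>B\<bar> ** E - \<bar>H\<bar> ** G)\<close> \<open>transpose E *v \<bar>r\<bar> - transpose G *v \<bar>\<delta>\<bar> \<le> s\<close>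
  have value_eq: "optimal_value x0 = ereal (p 0 \<bullet> x0)"
    if "solves_costate p" "transpose F *v p 0 \<le> \<gamma>" "0 \<le> x0" for p x0
    using optimal_gain_exists[OF that(1)] optimal_gain_optimal(2)[OF data that(1,2) _ that(3)] by blast
  obtain p where p: "solves_costate p" using costate_exists[OF \<open>0 \<le> T\<close>] .
  have "transpose F *v p 0 \<le> \<gamma>" if finite: "\<forall>x0\<ge>0. \<bar>optimal_value x0\<bar> \<noteq> \<infinity>"
  proof (rule ccontr)
    assume "\<not> ?thesis"
    \<comment> \<open>The impulse argument works from every initial state, so the origin
      suffices.\<close>
    then have "optimal_value 0 = \<infinity>"
      by (rule optimal_value_infinite[OF \<open>0 \<le> T\<close> \<open>0 \<le> \<gamma>\<close> p])
    then show False using finite[rule_format, of 0] by simp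
  qed
  then have "(\<forall>x0\<ge>0. \<bar>optimal_value x0\<bar> \<noteq> \<infinity>) \<longleftrightarrow> (\<exists>p. unique_costate p \<and> transpose F *v p 0 \<le> \<gamma>)"
    using p value_eq unfolding unique_costate_iff by (metis abs_ereal.simps(1) PInfty_neq_ereal(1))
  moreover have "optimal_policy x0 (\<lambda>t x. - (K t *v x))"
    if "solves_costate p" "transpose F *v p 0 \<le> \<gamma>" "optimal_gain p K" "0 \<le> x0" for p K x0
    by (rule optimal_gain_optimal(1)[OF data that])
  ultimately show ?thesis
    using value_eq optimal_gain_exists unfolding unique_costate_iff by blast
qed

end
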